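(* Let $X$ and $Y$ be nonsingular toric Fano $3$-folds, and $\varphi:Y\to X$ an equivariant (birational) morphism. Then $\varphi$ has a decomposition $$Y=X_r\stackrel{\varphi_r}{\longrightarrow}X_{r-1}\stackrel{\varphi_{r-1}}{\longrightarrow}\cdots\stackrel{\varphi_2}{\longrightarrow}X_1\stackrel{\varphi_1}{\longrightarrow}X_0=X$$ where each $X_i$ $(0\le i\le r)$ is a nonsingular toric Fano $3$-fold, each $\varphi_j$ $(2\le j\le r)$ is an equivariant blow-up along a $T_N$-invariant $1$-dimensional irreducible closed subvariety of $X_{j-1}$, and $\varphi_1$ is an equivariant blow-up along some (possibly empty) finite set of $T_N$-invariant points of $X$.
   Context: $N$ is a free abelian group of rank $3$ and $T_N$ the corresponding algebraic torus. A nonsingular toric Fano $3$-fold is a nonsingular complete $3$-dimensional toric variety whose anticanonical divisor is ample. $X=T_N\mathrm{emb}(\Sigma)$ and $Y=T_N\mathrm{emb}(\widetilde\Sigma)$ are the toric varieties of fans $\Sigma,\widetilde\Sigma$ in the same lattice $N$, and an equivariant morphism $Y\to X$ means the toric morphism induced by the identity of $N$, i.e. every cone of $\widetilde\Sigma$ is contained in a cone of $\Sigma$ (so it is proper and birational). Equivariant blow-ups are blow-ups along $T_N$-invariant closed subvarieties. *)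

theory Defs
  imports "HOL-Analysis.Analysis"
begin

text \<open>
  Toric varieties are handled through their fans. The Euclidean space \<open>'a\<close> is \<open>N\<close> tensored with
  the reals, and \<open>N\<close> is an arbitrary lattice of full rank in it; the inner product identifies the
  dual space with \<open>'a\<close> itself, so the character lattice \<open>M\<close> is the dual lattice of \<open>N\<close>.
  A fan \<open>\<Delta>\<close> stands for \<open>T\<^sub>N emb(\<Delta>)\<close>, and a cone \<open>\<tau> \<in> \<Delta>\<close> for the torus orbit of \<open>\<tau>\<close> and
  for its closure \<open>V(\<tau>)\<close>; these closures are exactly the invariant irreducible closed subvarieties.
\<close>

definition lattice_basis :: "'a::euclidean_space set \<Rightarrow> 'a set \<Rightarrow> bool" where
  "lattice_basis N B \<longleftrightarrow> independent B \<and> span B = UNIV \<and>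
     N = range (\<lambda>c :: 'a \<Rightarrow> int. \<Sum>b\<in>B. of_int (c b) *\<^sub>R b)"

definition full_lattice :: "'a::euclidean_space set \<Rightarrow> bool" where
  "full_lattice N \<longleftrightarrow> (\<exists>B. lattice_basis N B)"

definition dual_lattice :: "'a::euclidean_space set \<Rightarrow> 'a set" where
  "dual_lattice N = {u. \<forall>v\<in>N. u \<bullet> v \<in> \<int>}"


section \<open>Fans\<close>

definition strongly_convex_rational_cone :: "'a::euclidean_space set \<Rightarrow> 'a set \<Rightarrow> bool" where
  "strongly_convex_rational_cone N \<sigma> \<longleftrightarrow>
     (\<exists>A. finite A \<and> A \<subseteq> N \<and> \<sigma> = convex_cone hull A) \<and> \<sigma> \<inter> uminus ` \<sigma> = {0}"

text \<open>
  The library relation \<open>face_of\<close> also admits the empty set, which is not a face of a cone.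
  For polyhedral cones the nonempty faces in the sense of \<open>face_of\<close> are the intersections with
  supporting hyperplanes.
\<close>

definition cone_faces :: "'a::euclidean_space set \<Rightarrow> 'a set set" where
  "cone_faces \<sigma> = {\<tau>. \<tau> face_of \<sigma> \<and> \<tau> \<noteq> {}}"

definition fan :: "'a::euclidean_space set \<Rightarrow> 'a set set \<Rightarrow> bool" where
  "fan N \<Delta> \<longleftrightarrow> finite \<Delta> \<and> \<Delta> \<noteq> {} \<and>
     (\<forall>\<sigma>\<in>\<Delta>. strongly_convex_rational_cone N \<sigma>) \<and>
     (\<forall>\<sigma>\<in>\<Delta>. cone_faces \<sigma> \<subseteq> \<Delta>) \<and>
     (\<forall>\<sigma>\<in>\<Delta>. \<forall>\<tau>\<in>\<Delta>. \<sigma> \<inter> \<tau> \<in> cone_faces \<sigma> \<and> \<sigma> \<inter> \<tau> \<in> cone_faces \<tau>)"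

definition complete_fan :: "'a::euclidean_space set set \<Rightarrow> bool" where
  "complete_fan \<Delta> \<longleftrightarrow> \<Union>\<Delta> = UNIV"

text \<open>The variety is nonsingular iff every cone is generated by part of a basis of \<open>N\<close>.\<close>

definition nonsingular_fan :: "'a::euclidean_space set \<Rightarrow> 'a set set \<Rightarrow> bool" where
  "nonsingular_fan N \<Delta> \<longleftrightarrow>
     (\<forall>\<sigma>\<in>\<Delta>. \<exists>B A. lattice_basis N B \<and> A \<subseteq> B \<and> \<sigma> = convex_cone hull A)"

definition primitive_vector :: "'a::euclidean_space set \<Rightarrow> 'a \<Rightarrow> bool" where
  "primitive_vector N v \<longleftrightarrow> v \<in> N \<and> v \<noteq> 0 \<and> (\<forall>t. 0 < t \<and> t < 1 \<longrightarrow> t *\<^sub>R v \<notin> N)"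

text \<open>The primitive generators of the one-dimensional faces of a cone.\<close>

definition cone_gens :: "'a::euclidean_space set \<Rightarrow> 'a set \<Rightarrow> 'a set" where
  "cone_gens N \<sigma> = {v. primitive_vector N v \<and> convex_cone hull {v} \<in> cone_faces \<sigma>}"

definition fan_gens :: "'a::euclidean_space set \<Rightarrow> 'a set set \<Rightarrow> 'a set" where
  "fan_gens N \<Delta> = {v. primitive_vector N v \<and> convex_cone hull {v} \<in> \<Delta>}"

text \<open>The dimension of the orbit of \<open>\<tau>\<close>, which is also the dimension of \<open>V(\<tau>)\<close>.\<close>

definition orbit_dim :: "'a::euclidean_space set \<Rightarrow> int" where
  "orbit_dim \<tau> = int DIM('a) - aff_dim \<tau>"


section \<open>Invariant divisors and ampleness\<close>

text \<open>
  An invariant divisor \<open>D = \<Sum>\<^sub>v D(v) V(v)\<close> is given by its coefficients at the primitive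
  generators \<open>v\<close> of the rays of the fan; values of \<open>D\<close> elsewhere are irrelevant. The standard
  logarithmic form on the torus has a simple pole along each \<open>V(v)\<close> and no zeros, so the
  anticanonical divisor is the sum of all \<open>V(v)\<close>.
\<close>

definition anticanonical_divisor :: "'a::euclidean_space \<Rightarrow> int" where
  "anticanonical_divisor = (\<lambda>v. 1)"

text \<open>
  The character of \<open>u \<in> M\<close> has order \<open>u \<bullet> v\<close> along \<open>V(v)\<close>. As a section of \<open>O(D)\<close> it
  therefore has divisor \<open>\<Sum>\<^sub>v (u \<bullet> v + D(v)) V(v)\<close>: it is regular iff all these
  coefficients are nonnegative, and such characters form a basis of the global sections.
\<close>

definition character_sections ::
    "'a::euclidean_space set \<Rightarrow> 'a set set \<Rightarrow> ('a \<Rightarrow> int) \<Rightarrow> 'a set" where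
  "character_sections N \<Delta> D = {u \<in> dual_lattice N. \<forall>v\<in>fan_gens N \<Delta>. u \<bullet> v + of_int (D v) \<ge> 0}"

text \<open>
  The cones of the orbits on which the section \<open>u\<close> of \<open>O(D)\<close> does not vanish (for \<open>D\<close>
  Cartier, which is automatic on a nonsingular variety).
\<close>

definition nonvanishing_locus ::
    "'a::euclidean_space set \<Rightarrow> 'a set set \<Rightarrow> ('a \<Rightarrow> int) \<Rightarrow> 'a \<Rightarrow> 'a set set" where
  "nonvanishing_locus N \<Delta> D u = {\<rho>\<in>\<Delta>. \<forall>v\<in>cone_gens N \<rho>. u \<bullet> v + of_int (D v) = 0}"

text \<open>
  Ampleness of the line bundle \<open>O(D)\<close>: every point lies in an affine open set which is the
  nonvanishing locus of a section of a positive multiple \<open>O(kD)\<close>. For invariant \<open>D\<close> it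
  suffices to use characters as sections, and invariant open sets, which contain a point iff they
  contain its orbit; a nonempty invariant open set is affine iff it is \<open>U\<^sub>\<tau>\<close>, the union of the
  orbits of the faces of one cone \<open>\<tau>\<close> of the fan. On a complete fan this is the same as strict
  convexity of the support function of \<open>D\<close>.
\<close>

definition ample_divisor ::
    "'a::euclidean_space set \<Rightarrow> 'a set set \<Rightarrow> ('a \<Rightarrow> int) \<Rightarrow> bool" where
  "ample_divisor N \<Delta> D \<longleftrightarrow>
     (\<forall>\<sigma>\<in>\<Delta>. \<exists>k\<ge>1. \<exists>u\<in>character_sections N \<Delta> (\<lambda>v. k * D v). \<exists>\<tau>\<in>\<Delta>.
        \<sigma> \<in> nonvanishing_locus N \<Delta> (\<lambda>v. k * D v) u \<and>
        nonvanishing_locus N \<Delta> (\<lambda>v. k * D v) u = cone_faces \<tau>)"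

definition nonsingular_toric_fano :: "'a::euclidean_space set \<Rightarrow> 'a set set \<Rightarrow> bool" where
  "nonsingular_toric_fano N \<Delta> \<longleftrightarrow>
     fan N \<Delta> \<and> nonsingular_fan N \<Delta> \<and> complete_fan \<Delta> \<and>
     ample_divisor N \<Delta> anticanonical_divisor"


section \<open>Equivariant morphisms and blow-ups\<close>

text \<open>
  The identity of the lattice induces a morphism from the variety of \<open>\<Delta>'\<close> to that of \<open>\<Delta>\<close>.
  This morphism is determined by the two fans, so a composite of such morphisms
  is again the one determined by its source and target.
\<close>

definition equivariant_morphism :: "'a::euclidean_space set set \<Rightarrow> 'a set set \<Rightarrow> bool" where
  "equivariant_morphism \<Delta>' \<Delta> \<longleftrightarrow> (\<forall>\<sigma>'\<in>\<Delta>'. \<exists>\<sigma>\<in>\<Delta>. \<sigma>' \<subseteq> \<sigma>)"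

text \<open>
  The fan of the blow-up of a nonsingular toric variety along the union of the \<open>V(\<tau>)\<close>, \<open>\<tau> \<in> S\<close>,
  which are assumed to be pairwise disjoint (i.e. no cone of \<open>\<Delta>\<close> has two members of \<open>S\<close> as
  faces): the star subdivision at every \<open>\<tau> \<in> S\<close>, whose new ray is spanned by the sum of the
  primitive generators of \<open>\<tau>\<close>.
\<close>

definition blow_up :: "'a::euclidean_space set \<Rightarrow> 'a set set \<Rightarrow> 'a set set \<Rightarrow> 'a set set" where
  "blow_up N \<Delta> S =
     {\<sigma>\<in>\<Delta>. \<forall>\<tau>\<in>S. \<tau> \<notin> cone_faces \<sigma>} \<union>
     {convex_cone hull (insert (\<Sum>v\<in>cone_gens N \<tau>. v) \<sigma>') | \<tau> \<sigma>'.
        \<tau> \<in> S \<and> \<sigma>' \<in> \<Delta> \<and> \<tau> \<notin> cone_faces \<sigma>' \<and>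
        (\<exists>\<sigma>\<in>\<Delta>. \<tau> \<in> cone_faces \<sigma> \<and> \<sigma>' \<in> cone_faces \<sigma>)}"

text \<open>Distinct fixed points are disjoint, so \<open>blow_up\<close> applies to every set of them.\<close>

definition blow_up_along_points ::
    "'a::euclidean_space set \<Rightarrow> 'a set set \<Rightarrow> 'a set set \<Rightarrow> bool" where
  "blow_up_along_points N \<Delta>' \<Delta> \<longleftrightarrow>
     (\<exists>S. finite S \<and> S \<subseteq> {\<tau>\<in>\<Delta>. orbit_dim \<tau> = 0} \<and> \<Delta>' = blow_up N \<Delta> S)"

definition blow_up_along_curve ::
    "'a::euclidean_space set \<Rightarrow> 'a set set \<Rightarrow> 'a set set \<Rightarrow> bool" where
  "blow_up_along_curve N \<Delta>' \<Delta> \<longleftrightarrow>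
     (\<exists>\<tau>\<in>\<Delta>. orbit_dim \<tau> = 1 \<and> \<Delta>' = blow_up N \<Delta> {\<tau>})"

end

theory Submission
  imports Defs
begin

text \<open>
  A nonsingular complete fan is encoded by the simplicial complex \<open>K\<close> of the sets of primitive
  generators of its cones. Let \<open>deg\<close> be the function that is linear on every cone and \<open>1\<close> at every
  generator. It is integral on the lattice, and the lattice points of degree \<open>1\<close> are the generators.
  The variety is Fano iff \<open>deg\<close> is strictly convex: \<open>deg (x + y) \<le> deg x + deg y\<close>, with equality
  only for points of a common cone. Hence if two generators \<open>g\<close>, \<open>h\<close> of a Fano complex \<open>L\<close> do not
  span a cone, then \<open>deg (g + h) < 2\<close>, so that \<open>g + h\<close> is zero or again a generator. Everything
  below rests on this principle and on the uniqueness of coordinates.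

  Let \<open>L\<close> belong to \<open>Y\<close>, and let \<open>K\<close> be a complex in dimension three whose generators are among those
  of \<open>L\<close>. An edge \<open>{p, q}\<close> of \<open>K\<close> is a face of \<open>L\<close>, or else \<open>p + q\<close> is a generator of \<open>L\<close>, and
  then it divides the edge into two faces of \<open>L\<close>. A triangle whose edges are faces of \<open>L\<close> is
  itself a face of \<open>L\<close>, or else the sum of its vertices is a generator of \<open>L\<close>. So \<open>K = L\<close> as soon
  as neither edges nor triangles are subdivided (\<open>unsubdivided_eq\<close>). This leads to the
  decomposition: first blow up the points of all triangles of \<open>X\<close> whose vertices have a sum
  among the generators of \<open>L\<close> although their edges are not subdivided; then blow up, in any order,
  the curves of edges \<open>{p, q}\<close> with \<open>p + q\<close> a generator of \<open>L\<close>. No triangle of the first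
  kind ever reappears, and \<open>L\<close> has finitely many generators, so this ends with \<open>L\<close>.

  It remains to see that all these complexes are Fano. Convexity has to be checked across walls only
  (\<open>fano_if_convex_walls\<close>). For adjacent triangles \<open>{p, q, r}\<close> and \<open>{p, q, s}\<close> there are integers
  with \<open>r + s = \<alpha> p + \<beta> q\<close>, and the wall is strictly convex iff \<open>\<alpha> + \<beta> \<le> 1\<close>.
  Strict convexity of \<open>L\<close> yields this, with one exception: \<open>r + s = p + q\<close> where \<open>p + q\<close> is a
  generator of \<open>L\<close> (\<open>wall_relation\<close>). Such a wall does not exist in a Fano complex \<open>K\<close>, and
  the blow-ups above do not create one. Blowing up \<open>{a, b}\<close> would do so only next to a triangle
  \<open>{a, b, c}\<close> for which \<open>a + b\<close>, \<open>a + c\<close> and \<open>c - b\<close> are generators of \<open>L\<close>, and this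
  is impossible (\<open>no_adjacent_subdivided_edges\<close>). Blowing up the point of a triangle adds convex walls and
  otherwise changes the relations only of the edges of the triangle, which are not subdivided.
\<close>

section \<open>Nonnegative combinations and simplicial cones\<close>

text \<open>
  Linear combinations are given by coefficient functions on the whole space. They have finite support
  in every use, so that \<open>lin\<close> and \<open>total\<close> are the intended sums.
\<close>

definition supp :: "('a \<Rightarrow> real) \<Rightarrow> 'a set" where
  "supp c = {a. c a \<noteq> 0}"

definition lin :: "('a::real_vector \<Rightarrow> real) \<Rightarrow> 'a" where
  "lin c = (\<Sum>a\<in>supp c. c a *\<^sub>R a)"

definition total :: "('a \<Rightarrow> real) \<Rightarrow> real" where
  "total c = (\<Sum>a\<in>supp c. c a)"

abbreviation ccone :: "'a::euclidean_space set \<Rightarrow> 'a set" where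
  "ccone A \<equiv> convex_cone hull A"

lemma supp_subset: "supp c \<subseteq> A \<longleftrightarrow> (\<forall>a. a \<notin> A \<longrightarrow> c a = 0)"
  by (auto simp: supp_def)

lemma lin_eq_sum: "finite A \<Longrightarrow> supp c \<subseteq> A \<Longrightarrow> lin c = (\<Sum>a\<in>A. c a *\<^sub>R a)"
  unfolding lin_def by (rule sum.mono_neutral_left) (auto simp: supp_def)

lemma total_eq_sum: "finite A \<Longrightarrow> supp c \<subseteq> A \<Longrightarrow> total c = (\<Sum>a\<in>A. c a)"
  unfolding total_def by (rule sum.mono_neutral_left) (auto simp: supp_def)

lemma lin_add:
  assumes "finite A" "supp c \<subseteq> A" "supp d \<subseteq> A"
  shows "lin (\<lambda>a. c a + d a) = lin c + lin d" "total (\<lambda>a. c a + d a) = total c + total d"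
    "supp (\<lambda>a. c a + d a) \<subseteq> A"
proof -
  show s: "supp (\<lambda>a. c a + d a) \<subseteq> A" using assms by (simp add: supp_subset)
  show "lin (\<lambda>a. c a + d a) = lin c + lin d"
    using assms s by (simp add: lin_eq_sum[of A] sum.distrib scaleR_add_left)
  show "total (\<lambda>a. c a + d a) = total c + total d"
    using assms s by (simp add: total_eq_sum[of A] sum.distrib)
qed

lemma lin_scale:
  assumes "finite A" "supp c \<subseteq> A"
  shows "lin (\<lambda>a. t * c a) = t *\<^sub>R lin c" "total (\<lambda>a. t * c a) = t * total c"
    "supp (\<lambda>a. t * c a) \<subseteq> A"
proof -
  show s: "supp (\<lambda>a. t * c a) \<subseteq> A" using assms by (simp add: supp_subset)
  show "lin (\<lambda>a. t * c a) = t *\<^sub>R lin c"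
    using assms s by (simp add: lin_eq_sum[of A] scaleR_sum_right)
  show "total (\<lambda>a. t * c a) = t * total c"
    using assms s by (simp add: total_eq_sum[of A] sum_distrib_left)
qed

lemma lin_diff:
  assumes "finite A" "supp c \<subseteq> A" "supp d \<subseteq> A"
  shows "lin (\<lambda>a. c a - d a) = lin c - lin d" "supp (\<lambda>a. c a - d a) \<subseteq> A"
proof -
  show s: "supp (\<lambda>a. c a - d a) \<subseteq> A" using assms by (simp add: supp_subset)
  show "lin (\<lambda>a. c a - d a) = lin c - lin d"
    using assms s by (simp add: lin_eq_sum[of A] sum_subtractf scaleR_diff_left)
qed

lemma lin_single: "lin (\<lambda>b. if b = a then t else 0) = t *\<^sub>R a"
  "supp (\<lambda>b. if b = a then t else 0) \<subseteq> {a}"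
  by (simp_all add: lin_eq_sum[of "{a}"] supp_subset)

lemma lin_indicator:
  assumes "finite A"
  shows "lin (\<lambda>a. if a \<in> A then t else 0) = t *\<^sub>R \<Sum>A"
    "supp (\<lambda>a. if a \<in> A then t else 0) \<subseteq> A"
  using assms by (simp_all add: lin_eq_sum[of A] supp_subset scaleR_sum_right)

lemma lin_zero: "lin (\<lambda>_. 0) = 0"
  by (simp add: lin_def)

lemma lin_inj:
  assumes ind: "independent (A::'a::euclidean_space set)"
    and "supp c \<subseteq> A" "supp d \<subseteq> A" "lin c = lin d"
  shows "c = d"
proof
  fix a
  have fin: "finite A" using ind by (rule independent_imp_finite)
  have "(\<Sum>a\<in>A. (c a - d a) *\<^sub>R a) = 0"
    using assms fin by (simp add: lin_eq_sum[of A] scaleR_diff_left sum_subtractf)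
  then have "a \<in> A \<Longrightarrow> c a - d a = 0"
    using ind fin independentD[of A A "\<lambda>a. c a - d a"] by auto
  then show "c a = d a" using assms(2,3) by (cases "a \<in> A") (auto simp: supp_subset)
qed

lemma ccone_finite:
  assumes "finite (A::'a::euclidean_space set)"
  shows "x \<in> ccone A \<longleftrightarrow> (\<exists>c. (\<forall>a. 0 \<le> c a) \<and> supp c \<subseteq> A \<and> lin c = x)"
proof -
  let ?C = "{x. \<exists>c. (\<forall>a. 0 \<le> c a) \<and> supp c \<subseteq> A \<and> lin c = x}"
  have "ccone A = ?C"
  proof (rule hull_unique)
    show "A \<subseteq> ?C"
    proof
      fix a assume "a \<in> A"
      then show "a \<in> ?C"
        using lin_single[of a 1] by (intro CollectI exI[of _ "\<lambda>b. if b = a then 1 else 0"]) auto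
    qed
    show "convex_cone ?C"
      unfolding convex_cone_iff
    proof (intro conjI ballI allI impI)
      show "0 \<in> ?C" by (intro CollectI exI[of _ "\<lambda>_. 0"]) (simp add: lin_zero supp_def)
    next
      fix x y assume "x \<in> ?C" "y \<in> ?C"
      then obtain c d where "\<forall>a. 0 \<le> c a" "supp c \<subseteq> A" "lin c = x"
        "\<forall>a. 0 \<le> d a" "supp d \<subseteq> A" "lin d = y" by auto
      then show "x + y \<in> ?C"
        using lin_add[OF assms, of c d] by (intro CollectI exI[of _ "\<lambda>a. c a + d a"]) auto
    next
      fix x and t::real assume "x \<in> ?C" "t \<ge> 0"
      then obtain c where "\<forall>a. 0 \<le> c a" "supp c \<subseteq> A" "lin c = x" by auto
      then show "t *\<^sub>R x \<in> ?C"
        using lin_scale[OF assms, of c t] \<open>t \<ge> 0\<close>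
        by (intro CollectI exI[of _ "\<lambda>a. t * c a"]) auto
    qed
    fix S' :: "'a set" assume S': "A \<subseteq> S'" "convex_cone S'"
    show "?C \<subseteq> S'"
    proof
      fix x assume "x \<in> ?C"
      then obtain c where c: "\<forall>a. 0 \<le> c a" "supp c \<subseteq> A" "lin c = x" by auto
      have "B \<subseteq> A \<Longrightarrow> (\<Sum>a\<in>B. c a *\<^sub>R a) \<in> S'" if "finite B" for B
        using that
      proof (induction B)
        case empty
        show ?case using S'(2) by (simp add: convex_cone_contains_0)
      next
        case (insert b B)
        then show ?case using S' c(1)
          by (auto intro!: convex_cone_add convex_cone_scaleR)
      qed
      from this[OF assms] show "x \<in> S'" using c assms by (simp add: lin_eq_sum[of A])
    qed
  qed
  then show ?thesis by blast
qed

lemma lin_in_ccone: "finite A \<Longrightarrow> \<forall>a. 0 \<le> c a \<Longrightarrow> supp c \<subseteq> A \<Longrightarrow> lin c \<in> ccone A"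
  by (auto simp: ccone_finite)

lemma ccone_subset_span: "ccone A \<subseteq> span (A::'a::euclidean_space set)"
  by (simp add: convex_cone_span hull_minimal span_superset)

lemma ccone_independent_mem:
  assumes "independent (A::'a::euclidean_space set)" "supp c \<subseteq> A" "B \<subseteq> A"
  shows "lin c \<in> ccone B \<longleftrightarrow> (\<forall>a. 0 \<le> c a) \<and> supp c \<subseteq> B"
proof -
  have fin: "finite A" "finite B"
    using assms independent_imp_finite finite_subset by blast+
  show ?thesis
  proof
    assume "lin c \<in> ccone B"
    then obtain d where d: "\<forall>a. 0 \<le> d a" "supp d \<subseteq> B" "lin d = lin c"
      using ccone_finite[OF fin(2)] by auto
    then have "d = c" using lin_inj[OF assms(1), of d c] assms by auto
    then show "(\<forall>a. 0 \<le> c a) \<and> supp c \<subseteq> B" using d by simp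
  qed (use fin in \<open>auto intro: lin_in_ccone\<close>)
qed

lemma independent_span_lin:
  assumes "independent (A::'a::euclidean_space set)" "x \<in> span A"
  obtains c where "supp c \<subseteq> A" "lin c = x"
proof -
  have fin: "finite A" using assms by (simp add: independent_imp_finite)
  obtain u where u: "x = (\<Sum>a\<in>A. u a *\<^sub>R a)"
    using assms(2) span_finite[OF fin] by auto
  show thesis
    by (rule that[of "\<lambda>a. if a \<in> A then u a else 0"])
      (use u fin in \<open>auto simp: supp_subset lin_eq_sum[of A] intro!: sum.cong\<close>)
qed

text \<open>
  A nonempty face of a cone is a convex cone, and with a point it contains all summands of this point
  in the cone; so it contains every generator that occurs in one of its points with positive coefficient.
\<close>

lemma cone_faces_ccone:
  assumes ind: "independent (A::'a::euclidean_space set)"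
  shows "cone_faces (ccone A) = (\<lambda>B. ccone B) ` Pow A"
proof (intro equalityI subsetI)
  have fin: "finite A" using ind by (rule independent_imp_finite)
  fix F assume "F \<in> cone_faces (ccone A)"
  then have F: "F face_of ccone A" "F \<noteq> {}" by (auto simp: cone_faces_def)
  have FA: "F \<subseteq> ccone A" using F face_of_imp_subset by blast
  have conv: "convex F" using F(1) by (rule face_of_imp_convex)
  have seg: "x \<in> F \<and> y \<in> F"
    if "x \<in> ccone A" "y \<in> ccone A" "0 < t" "t < 1" "(1 - t) *\<^sub>R x + t *\<^sub>R y \<in> F" for x y t
  proof (cases "x = y")
    case True
    then show ?thesis using that by (simp add: scaleR_left_distrib[symmetric])
  next
    case False
    then have "(1 - t) *\<^sub>R x + t *\<^sub>R y \<in> open_segment x y"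
      using that by (auto simp: in_segment)
    then show ?thesis using F(1) that by (auto simp: face_of_def)
  qed
  have zero: "0 \<in> F"
  proof -
    obtain z where "z \<in> F" using F by auto
    then show ?thesis
      using seg[of 0 "2 *\<^sub>R z" "1/2"] FA by (auto simp: convex_cone_hull_mul convex_cone_hull_contains_0)
  qed
  have scale: "t *\<^sub>R x \<in> F" if "x \<in> F" "0 \<le> t" for t x
  proof (cases "t \<le> 1")
    case True
    then show ?thesis using convexD_alt[OF conv zero that(1), of t] that by simp
  next
    case False
    then show ?thesis using seg[of 0 "t *\<^sub>R x" "1/t"] that FA
      by (auto simp: convex_cone_hull_mul convex_cone_hull_contains_0)
  qed
  have add: "x + y \<in> F" if "x \<in> F" "y \<in> F" for x y
    using scale[OF convexD_alt[OF conv that, of "1/2"], of 2] by (simp add: scaleR_add_right)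
  have summand: "x \<in> F" if "x \<in> ccone A" "y \<in> ccone A" "x + y \<in> F" for x y
    using scale[of "2 *\<^sub>R x" "1/2"] seg[of "2 *\<^sub>R x" "2 *\<^sub>R y" "1/2"] that
    by (simp add: convex_cone_hull_mul)
  have "F = ccone (A \<inter> F)"
  proof
    have "convex_cone F" using zero add scale by (auto simp: convex_cone_iff)
    then show "ccone (A \<inter> F) \<subseteq> F" by (simp add: hull_minimal)
    show "F \<subseteq> ccone (A \<inter> F)"
    proof
      fix x assume x: "x \<in> F"
      then obtain c where c: "\<forall>a. 0 \<le> c a" "supp c \<subseteq> A" "lin c = x"
        using FA ccone_finite[OF fin] by blast
      have "a \<in> F" if a: "a \<in> supp c" for a
      proof -
        let ?d = "\<lambda>b. if b = a then 0 else c b"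
        have sd: "supp ?d \<subseteq> A" using c by (auto simp: supp_def)
        have aA: "a \<in> A" using a c by auto
        have "lin ?d = x - c a *\<^sub>R a"
          using sd c fin aA
          by (simp add: lin_eq_sum[of A] sum.remove[of A a] if_distrib cong: if_cong)
            (auto intro!: sum.cong)
        then have "x = c a *\<^sub>R a + lin ?d" by simp
        moreover have "lin ?d \<in> ccone A" using sd c fin by (intro lin_in_ccone) auto
        moreover have "c a *\<^sub>R a \<in> ccone A" using c aA by (simp add: convex_cone_hull_mul hull_inc)
        ultimately have "c a *\<^sub>R a \<in> F" using summand x by blast
        moreover have "c a > 0" using a c(1) by (simp add: supp_def less_le)
        ultimately show ?thesis using scale[of "c a *\<^sub>R a" "1 / c a"] by simp
      qed
      then show "x \<in> ccone (A \<inter> F)"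
        using c fin by (auto simp: ccone_finite[of "A \<inter> F"])
    qed
  qed
  then show "F \<in> (\<lambda>B. ccone B) ` Pow A" by blast
next
  have fin: "finite A" using ind by (rule independent_imp_finite)
  fix F assume "F \<in> (\<lambda>B. ccone B) ` Pow A"
  then obtain B where B: "B \<subseteq> A" "F = ccone B" by auto
  have "ccone B face_of ccone A"
    unfolding face_of_def
  proof (intro conjI ballI impI)
    show "ccone B \<subseteq> ccone A" using B by (simp add: hull_mono)
    show "convex (ccone B)" by (rule convex_convex_cone_hull)
    fix x y z assume h: "x \<in> ccone A" "y \<in> ccone A" "z \<in> ccone B" "z \<in> open_segment x y"
    then obtain t where t: "0 < t" "t < 1" "z = (1 - t) *\<^sub>R x + t *\<^sub>R y" by (auto simp: in_segment)
    obtain c d where c: "\<forall>a. 0 \<le> c a" "supp c \<subseteq> A" "lin c = x"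
      and d: "\<forall>a. 0 \<le> d a" "supp d \<subseteq> A" "lin d = y"
      using h ccone_finite[OF fin] by blast
    let ?e = "\<lambda>a. (1 - t) * c a + t * d a"
    have e: "lin ?e = z" "supp ?e \<subseteq> A"
      using lin_add[OF fin lin_scale(3)[OF fin c(2)] lin_scale(3)[OF fin d(2)]]
        lin_scale[OF fin c(2)] lin_scale[OF fin d(2)] t c d by auto
    have "supp ?e \<subseteq> B"
      using ccone_independent_mem[OF ind e(2) B(1)] e(1) h(3) by simp
    then have "c a = 0 \<and> d a = 0" if "a \<notin> B" for a
    proof -
      have "(1 - t) * c a + t * d a = 0" using \<open>supp ?e \<subseteq> B\<close> that by (auto simp: supp_def)
      moreover have "0 \<le> (1 - t) * c a" "0 \<le> t * d a" using t c d by auto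
      ultimately have "(1 - t) * c a = 0" "t * d a = 0" by linarith+
      then show ?thesis using t by auto
    qed
    then have "supp c \<subseteq> B" "supp d \<subseteq> B" by (auto simp: supp_def)
    then show "x \<in> ccone B" "y \<in> ccone B"
      using c d lin_in_ccone[OF finite_subset[OF B(1) fin]] by blast+
  qed
  then show "F \<in> cone_faces (ccone A)"
    using B convex_cone_hull_nonempty by (auto simp: cone_faces_def)
qed

section \<open>Lattice bases\<close>

lemma lattice_basis_finite: "lattice_basis N B \<Longrightarrow> finite B"
  by (simp add: lattice_basis_def independent_imp_finite)

lemma lattice_basis_card: "lattice_basis N (B::'a::euclidean_space set) \<Longrightarrow> card B = DIM('a)"
  by (metis basis_card_eq_dim dim_UNIV lattice_basis_def subset_UNIV)

lemma lattice_basis_independent: "lattice_basis N B \<Longrightarrow> A \<subseteq> B \<Longrightarrow> independent A"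
  using independent_mono by (auto simp: lattice_basis_def)

lemma lattice_basis_mem:
  assumes B: "lattice_basis N (B::'a::euclidean_space set)" and c: "supp c \<subseteq> B"
  shows "lin c \<in> N \<longleftrightarrow> (\<forall>a. c a \<in> \<int>)"
proof
  have fin: "finite B" using B by (rule lattice_basis_finite)
  assume "lin c \<in> N"
  then obtain k :: "'a \<Rightarrow> int" where k: "lin c = (\<Sum>b\<in>B. of_int (k b) *\<^sub>R b)"
    using B by (auto simp: lattice_basis_def)
  let ?k = "\<lambda>b. if b \<in> B then of_int (k b) else (0::real)"
  have s: "supp ?k \<subseteq> B" by (auto simp: supp_def)
  have "lin ?k = lin c" using k s fin by (simp add: lin_eq_sum[of B] cong: sum.cong)
  then have "c = ?k"
    using lin_inj[of B c ?k] B c s by (auto simp: lattice_basis_def)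
  then show "\<forall>a. c a \<in> \<int>" by (metis Ints_0 Ints_of_int)
next
  have fin: "finite B" using B by (rule lattice_basis_finite)
  assume "\<forall>a. c a \<in> \<int>"
  then have f: "of_int \<lfloor>c a\<rfloor> = c a" for a by (auto elim: Ints_cases)
  have "lin c = (\<Sum>b\<in>B. of_int \<lfloor>c b\<rfloor> *\<^sub>R b)" using c fin by (simp add: lin_eq_sum[of B] f)
  then show "lin c \<in> N" using B by (auto simp: lattice_basis_def)
qed

lemma lattice_basis_lin:
  assumes "lattice_basis N (B::'a::euclidean_space set)"
  obtains c where "supp c \<subseteq> B" "lin c = x"
  using independent_span_lin[of B x] assms by (auto simp: lattice_basis_def)

lemma lattice_basis_subset: "lattice_basis N B \<Longrightarrow> B \<subseteq> N"
proof
  fix b assume B: "lattice_basis N B" "b \<in> B"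
  then show "b \<in> N"
    using lattice_basis_mem[OF B(1), of "\<lambda>a. if a = b then 1 else 0"] lin_single[of b 1]
    by (auto simp: supp_subset)
qed

lemma lattice_closed:
  assumes "lattice_basis N (B::'a::euclidean_space set)" "x \<in> N" "y \<in> N"
  shows "x + y \<in> N" "x - y \<in> N"
proof -
  have fin: "finite B" using assms by (simp add: lattice_basis_finite)
  obtain c d where c: "supp c \<subseteq> B" "lin c = x" and d: "supp d \<subseteq> B" "lin d = y"
    using lattice_basis_lin[OF assms(1)] by metis
  have i: "\<forall>a. c a \<in> \<int>" "\<forall>a. d a \<in> \<int>"
    using lattice_basis_mem[OF assms(1)] c d assms by auto
  show "x + y \<in> N"
    using lin_add[OF fin c(1) d(1)] lattice_basis_mem[OF assms(1) lin_add(3)[OF fin c(1) d(1)]] i c d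
    by auto
  show "x - y \<in> N"
    using lin_diff[OF fin c(1) d(1)] lattice_basis_mem[OF assms(1) lin_diff(2)[OF fin c(1) d(1)]] i c d
    by auto
qed

lemma lattice_sum:
  assumes "lattice_basis N (B::'a::euclidean_space set)" "finite A" "A \<subseteq> N"
  shows "\<Sum>A \<in> N"
  using assms(2,3)
proof (induction A)
  case empty
  show ?case using lattice_basis_mem[OF assms(1), of "\<lambda>_. 0"] by (simp add: lin_zero supp_def)
next
  case (insert a A)
  then show ?case using lattice_closed(1)[OF assms(1)] by simp
qed

text \<open>
  The change of coordinates is triangular with diagonal entries \<open>1\<close>. This is the reason why the blow-up
  of a nonsingular toric variety along an invariant subvariety is nonsingular.
\<close>

lemma lattice_basis_exchange:
  assumes B: "lattice_basis N (B::'a::euclidean_space set)" and T: "T \<subseteq> B" "t \<in> T"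
  shows "lattice_basis N (insert (\<Sum>T) (B - {t}))"
proof -
  have fin: "finite B" using B by (rule lattice_basis_finite)
  have ind: "independent B" and sp: "span B = UNIV" using B by (auto simp: lattice_basis_def)
  have finT: "finite T" using T fin finite_subset by blast
  define e where "e = \<Sum>T"
  have et: "e = t + \<Sum>(T - {t})" using finT T by (simp add: e_def sum.remove)
  have rest: "\<Sum>(T - {t}) \<in> span (B - {t})"
    using T by (intro span_sum) (auto intro: span_base)
  have tn: "t \<notin> span (B - {t})" using ind T by (auto simp: dependent_def)
  have en: "e \<notin> span (B - {t})"
    using tn rest unfolding et by (metis add_diff_cancel_right' span_diff)
  have ind': "independent (insert e (B - {t}))"
    using en ind independent_mono[of B "B - {t}"] by (intro independent_insertI) auto
  have "t \<in> span (insert e (B - {t}))"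
  proof -
    have "e - \<Sum>(T - {t}) \<in> span (insert e (B - {t}))"
      using rest span_mono[of "B - {t}" "insert e (B - {t})"]
      by (intro span_diff) (auto intro: span_base)
    then show ?thesis by (simp add: et)
  qed
  moreover have "B - {t} \<subseteq> span (insert e (B - {t}))"
    using span_superset[of "insert e (B - {t})"] by blast
  ultimately have "B \<subseteq> span (insert e (B - {t}))" by blast
  then have sp': "span (insert e (B - {t})) = UNIV"
    using sp span_minimal[of B "span (insert e (B - {t}))"] by (simp add: top.extremum_unique)
  have enB: "e \<notin> B - {t}" using en span_base[of e "B - {t}"] by blast
  have coeff: "(\<Sum>b\<in>insert e (B - {t}). k b *\<^sub>R b)
      = (\<Sum>b\<in>B. (if b \<in> T then (if b = t then k e else k b + k e) else k b) *\<^sub>R b)" for k :: "'a \<Rightarrow> real"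
  proof -
    have tB: "t \<in> B" using T by auto
    have "(\<Sum>b\<in>B. (if b \<in> T then (if b = t then k e else k b + k e) else k b) *\<^sub>R b)
       = k e *\<^sub>R t + (\<Sum>b\<in>B - {t}. (if b \<in> T then (if b = t then k e else k b + k e) else k b) *\<^sub>R b)"
      using T by (subst sum.remove[OF fin tB]) auto
    also have "\<dots> = k e *\<^sub>R t + (\<Sum>b\<in>B - {t}. k b *\<^sub>R b + (if b \<in> T then k e *\<^sub>R b else 0))"
      by (auto intro!: sum.cong simp: scaleR_add_left split: if_splits)
    also have "\<dots> = k e *\<^sub>R t + ((\<Sum>b\<in>B - {t}. k b *\<^sub>R b) + (\<Sum>b\<in>T - {t}. k e *\<^sub>R b))"
    proof -
      have "(\<Sum>b\<in>B - {t}. (if b \<in> T then k e *\<^sub>R b else 0)) = (\<Sum>b\<in>T - {t}. k e *\<^sub>R b)"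
        using T fin by (intro sum.mono_neutral_cong_right) auto
      then show ?thesis by (simp add: sum.distrib)
    qed
    also have "\<dots> = (\<Sum>b\<in>insert e (B - {t}). k b *\<^sub>R b)"
      using enB fin by (simp add: et scaleR_add_right scaleR_sum_right)
    finally show ?thesis by simp
  qed
  have eN: "e \<in> N" unfolding e_def
    using lattice_sum[OF B finT] T lattice_basis_subset[OF B] by auto
  have "N = range (\<lambda>c :: 'a \<Rightarrow> int. \<Sum>b\<in>insert e (B - {t}). of_int (c b) *\<^sub>R b)"
  proof (intro equalityI subsetI)
    fix x assume "x \<in> N"
    then obtain k :: "'a \<Rightarrow> int" where k: "x = (\<Sum>b\<in>B. of_int (k b) *\<^sub>R b)"
      using B by (auto simp: lattice_basis_def)
    have "t \<noteq> 0" using tn span_zero by auto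
    let ?c = "\<lambda>b. if b = e then k t else if b \<in> T then k b - k t else k b"
    have "(\<Sum>b\<in>insert e (B - {t}). of_int (?c b) *\<^sub>R b) = x"
      unfolding coeff k
    proof (rule sum.cong)
      fix b assume "b \<in> B"
      show "(if b \<in> T then if b = t then real_of_int (?c e) else real_of_int (?c b) + real_of_int (?c e)
            else real_of_int (?c b)) *\<^sub>R b = real_of_int (k b) *\<^sub>R b"
        using enB \<open>b \<in> B\<close> T by (cases "b = t") auto
    qed simp
    then show "x \<in> range (\<lambda>c :: 'a \<Rightarrow> int. \<Sum>b\<in>insert e (B - {t}). of_int (c b) *\<^sub>R b)"
      by (intro image_eqI[of _ _ ?c]) auto
  next
    fix x assume "x \<in> range (\<lambda>c :: 'a \<Rightarrow> int. \<Sum>b\<in>insert e (B - {t}). of_int (c b) *\<^sub>R b)"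
    then obtain c :: "'a \<Rightarrow> int" where c: "x = (\<Sum>b\<in>insert e (B - {t}). of_int (c b) *\<^sub>R b)" by auto
    let ?k = "\<lambda>b. if b \<in> T then (if b = t then c e else c b + c e) else c b"
    have "x = (\<Sum>b\<in>B. of_int (?k b) *\<^sub>R b)"
      unfolding c coeff by (intro sum.cong) auto
    then show "x \<in> N" using B by (auto simp: lattice_basis_def)
  qed
  then show ?thesis using ind' sp' by (simp add: lattice_basis_def e_def)
qed

lemma lattice_basis_primitive:
  assumes B: "lattice_basis N (B::'a::euclidean_space set)" and b: "b \<in> B"
  shows "t *\<^sub>R b \<in> N \<longleftrightarrow> t \<in> \<int>" "primitive_vector N b" "b \<noteq> 0"
proof -
  show i: "t *\<^sub>R b \<in> N \<longleftrightarrow> t \<in> \<int>" for t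
    using lattice_basis_mem[OF B, of "\<lambda>a. if a = b then t else 0"] lin_single[of b t] b
    by (auto simp: supp_subset split: if_splits)
  show b0: "b \<noteq> 0" using B b dependent_zero by (auto simp: lattice_basis_def)
  show "primitive_vector N b"
    using i b0 i[of 1] by (auto simp: primitive_vector_def elim!: Ints_cases)
qed

lemma primitive_on_ray:
  assumes "primitive_vector N v" "primitive_vector N w" "v = t *\<^sub>R w" "0 \<le> t"
  shows "v = w"
proof -
  have v: "v \<in> N" "v \<noteq> 0" and w: "w \<in> N" "w \<noteq> 0" using assms by (auto simp: primitive_vector_def)
  have "t > 0" using assms v by (cases "t = 0") auto
  have "\<not> t < 1" using assms(2,3) \<open>t > 0\<close> v unfolding primitive_vector_def by auto
  moreover have "\<not> t > 1"
  proof
    assume "t > 1"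
    then have "0 < inverse t" "inverse t < 1" "inverse t *\<^sub>R v = w"
      using assms(3) by (auto simp: inverse_less_1_iff)
    then show False using assms(1) w unfolding primitive_vector_def by metis
  qed
  ultimately show ?thesis using assms(3) by simp
qed

text \<open>
  Hence a nonsingular cone determines its set of generators, which makes the passage from fans to
  complexes of generators possible.
\<close>

lemma cone_gens_ccone:
  assumes B: "lattice_basis N (B::'a::euclidean_space set)" and A: "A \<subseteq> B"
  shows "cone_gens N (ccone A) = A"
proof (intro equalityI subsetI)
  have ind: "independent A" using B A by (rule lattice_basis_independent)
  fix v assume "v \<in> cone_gens N (ccone A)"
  then obtain C where v: "primitive_vector N v" and C: "C \<subseteq> A" "ccone {v} = ccone C"
    by (auto simp: cone_gens_def cone_faces_ccone[OF ind])
  have "v \<noteq> 0" using v by (auto simp: primitive_vector_def)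
  have "C \<noteq> {}"
  proof
    assume "C = {}"
    then have "ccone {v} = {0}" using C(2) by (simp add: hull_unique convex_cone_contains_0)
    then show False using \<open>v \<noteq> 0\<close> hull_inc[of v "{v}" convex_cone] by auto
  qed
  then obtain a where a: "a \<in> C" by auto
  then have "a \<in> ccone {v}" using C by (simp add: hull_inc)
  then obtain c where c: "\<forall>a. 0 \<le> c a" "supp c \<subseteq> {v}" "lin c = a"
    using ccone_finite[of "{v}"] by auto
  define t where "t = c v"
  have t: "a = t *\<^sub>R v" "t \<ge> 0" using c by (auto simp: lin_eq_sum[of "{v}"] t_def)
  then have "a = v" using primitive_on_ray[of N a v t] v lattice_basis_primitive[OF B, of a] a C A by auto
  then show "v \<in> A" using a C by auto
next
  have ind: "independent A" using B A by (rule lattice_basis_independent)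
  fix v assume "v \<in> A"
  then show "v \<in> cone_gens N (ccone A)"
    using lattice_basis_primitive(2)[OF B, of v] A
    by (auto simp: cone_gens_def cone_faces_ccone[OF ind])
qed

lemma lattice_basis_dual:
  assumes B: "lattice_basis N (B::'a::euclidean_space set)"
  obtains u where "u \<in> dual_lattice N" "\<forall>b\<in>B. u \<bullet> b = of_int (f b)"
proof -
  have fin: "finite B" using B by (rule lattice_basis_finite)
  obtain g :: "'a \<Rightarrow> real" where g: "linear g" "\<forall>b\<in>B. g b = of_int (f b)"
    using linear_independent_extend[of B "\<lambda>b. of_int (f b)"] B by (auto simp: lattice_basis_def)
  define u where "u = adjoint g 1"
  have u: "u \<bullet> x = g x" for x
    using adjoint_works[OF g(1), of x 1] by (simp add: u_def inner_commute)
  have "u \<in> dual_lattice N"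
    unfolding dual_lattice_def
  proof (intro CollectI ballI)
    fix v assume "v \<in> N"
    then obtain k :: "'a \<Rightarrow> int" where k: "v = (\<Sum>b\<in>B. of_int (k b) *\<^sub>R b)"
      using B by (auto simp: lattice_basis_def)
    have "u \<bullet> v = (\<Sum>b\<in>B. of_int (k b * f b))"
      using g(2) u by (simp add: k inner_sum_right)
    then show "u \<bullet> v \<in> \<int>" by (metis Ints_of_int of_int_sum)
  qed
  then show thesis using that u g by auto
qed


section \<open>Smooth complete fans as simplicial complexes of generators\<close>

definition repr :: "'a::real_vector set set \<Rightarrow> ('a \<Rightarrow> real) \<Rightarrow> 'a \<Rightarrow> bool" where
  "repr K c x \<longleftrightarrow> (\<forall>a. 0 \<le> c a) \<and> supp c \<in> K \<and> lin c = x"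

text \<open>
  The last axiom says at once that the cones cover the space and that they form a fan: every point has
  positive coordinates in exactly one cone. It reduces statements about intersections of cones
  to the uniqueness of coordinates.
\<close>

locale smooth_complex =
  fixes N :: "'a::euclidean_space set" and K :: "'a set set"
  assumes finite_complex: "finite K"
    and subset_closed: "\<lbrakk>A \<in> K; A' \<subseteq> A\<rbrakk> \<Longrightarrow> A' \<in> K"
    and part_of_basis: "A \<in> K \<Longrightarrow> \<exists>B. lattice_basis N B \<and> A \<subseteq> B"
    and ex1_repr: "\<exists>!c. repr K c x"
begin

definition coord :: "'a \<Rightarrow> 'a \<Rightarrow> real" where
  "coord x = (THE c. repr K c x)"

text \<open>
  Up to sign this is the support function of the anticanonical divisor.
\<close>

definition deg :: "'a \<Rightarrow> real" where
  "deg x = total (coord x)"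

abbreviation V :: "'a set" where
  "V \<equiv> \<Union>K"

lemma face_finite: "A \<in> K \<Longrightarrow> finite A"
  using part_of_basis lattice_basis_finite finite_subset by blast

lemma face_independent: "A \<in> K \<Longrightarrow> independent A"
  using part_of_basis lattice_basis_independent by blast

lemma repr_coord: "repr K (coord x) x"
  unfolding coord_def using theI'[OF ex1_repr[of x]] .

lemma coord_unique: "repr K c x \<Longrightarrow> coord x = c"
  using ex1_repr repr_coord by blast

lemma coord_nonneg: "0 \<le> coord x a"
  and coord_supp: "supp (coord x) \<in> K"
  and lin_coord: "lin (coord x) = x"
  using repr_coord[of x] by (auto simp: repr_def)

lemma coord_lin: "\<lbrakk>A \<in> K; \<forall>a. 0 \<le> c a; supp c \<subseteq> A\<rbrakk> \<Longrightarrow> coord (lin c) = c"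
  by (rule coord_unique) (auto simp: repr_def intro: subset_closed)

lemma empty_face: "{} \<in> K"
  using subset_closed[OF coord_supp[of 0]] by simp

lemma mem_ccone_iff:
  assumes "A \<in> K"
  shows "x \<in> ccone A \<longleftrightarrow> supp (coord x) \<subseteq> A"
proof
  assume "x \<in> ccone A"
  then obtain c where "\<forall>a. 0 \<le> c a" "supp c \<subseteq> A" "lin c = x"
    using ccone_finite[OF face_finite[OF assms]] by auto
  then show "supp (coord x) \<subseteq> A" using coord_lin[OF assms, of c] by auto
next
  assume "supp (coord x) \<subseteq> A"
  then show "x \<in> ccone A"
    using lin_in_ccone[OF face_finite[OF assms], of "coord x"] coord_nonneg lin_coord by auto
qed

lemma mem_own_ccone: "x \<in> ccone (supp (coord x))"
  by (simp add: mem_ccone_iff coord_supp)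

lemma coord_add:
  assumes A: "A \<in> K" and "x \<in> ccone A" "y \<in> ccone A"
  shows "coord (x + y) = (\<lambda>a. coord x a + coord y a)" "deg (x + y) = deg x + deg y"
proof -
  have s: "supp (coord x) \<subseteq> A" "supp (coord y) \<subseteq> A" using assms mem_ccone_iff by auto
  note l = lin_add[OF face_finite[OF A] s]
  show c: "coord (x + y) = (\<lambda>a. coord x a + coord y a)"
    using coord_lin[OF A, of "\<lambda>a. coord x a + coord y a"] l coord_nonneg lin_coord by simp
  show "deg (x + y) = deg x + deg y" using c l by (simp add: deg_def)
qed

lemma coord_scale:
  assumes "0 \<le> t"
  shows "coord (t *\<^sub>R x) = (\<lambda>a. t * coord x a)" "deg (t *\<^sub>R x) = t * deg x"
proof -
  note l = lin_scale[OF face_finite[OF coord_supp[of x]] subset_refl, of t]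
  show c: "coord (t *\<^sub>R x) = (\<lambda>a. t * coord x a)"
    using coord_lin[OF coord_supp[of x], of "\<lambda>a. t * coord x a"] l coord_nonneg lin_coord assms
    by simp
  show "deg (t *\<^sub>R x) = t * deg x" using c l by (simp add: deg_def)
qed

lemma deg_nonneg: "0 \<le> deg x"
  by (auto simp: deg_def total_def coord_nonneg intro: sum_nonneg)

lemma deg_eq_0_iff: "deg x = 0 \<longleftrightarrow> x = 0"
proof
  assume "deg x = 0"
  then have "\<forall>a\<in>supp (coord x). coord x a = 0"
    using face_finite[OF coord_supp[of x]] coord_nonneg
    by (simp add: deg_def total_def sum_nonneg_eq_0_iff)
  then have "supp (coord x) = {}" by (auto simp: supp_def)
  then show "x = 0" using lin_coord[of x] by (simp add: lin_def)
next
  assume "x = 0"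
  then show "deg x = 0" using coord_scale(2)[of 0 0] by simp
qed

lemma vertex_face: "v \<in> V \<Longrightarrow> {v} \<in> K"
  using subset_closed by blast

lemma coord_vertex:
  assumes "v \<in> V"
  shows "coord v = (\<lambda>b. if b = v then 1 else 0)" "supp (coord v) = {v}" "deg v = 1"
proof -
  show c: "coord v = (\<lambda>b. if b = v then 1 else 0)"
    using coord_lin[OF vertex_face[OF assms], of "\<lambda>b. if b = v then 1 else 0"] lin_single[of v 1]
    by simp
  show s: "supp (coord v) = {v}" by (auto simp: c supp_def)
  show "deg v = 1" unfolding deg_def total_def s by (simp add: c)
qed

lemma vertex_lattice:
  assumes "v \<in> V"
  shows "v \<in> N" "v \<noteq> 0" "primitive_vector N v"
proof -
  obtain B where B: "lattice_basis N B" "v \<in> B" using assms part_of_basis by blast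
  show "v \<in> N" using B lattice_basis_subset by blast
  show "v \<noteq> 0" "primitive_vector N v" using lattice_basis_primitive[OF B] by auto
qed

lemma some_basis: obtains B where "lattice_basis N B"
  using part_of_basis empty_face by blast

lemma lattice_add: "x \<in> N \<Longrightarrow> y \<in> N \<Longrightarrow> x + y \<in> N"
  and lattice_diff: "x \<in> N \<Longrightarrow> y \<in> N \<Longrightarrow> x - y \<in> N"
  using some_basis lattice_closed by metis+

lemma coord_Ints: "x \<in> N \<Longrightarrow> coord x a \<in> \<int>"
  using part_of_basis[OF coord_supp[of x]] lattice_basis_mem lin_coord by metis

lemma deg_Ints: "x \<in> N \<Longrightarrow> deg x \<in> \<int>"
  unfolding deg_def total_def by (intro Ints_sum coord_Ints)

text \<open>
  The coordinates of lattice points are nonnegative integers, so a generator of the cone of a nonzero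
  lattice point can be split off. Therefore \<open>deg\<close> counts generators: the lattice points of degree \<open>1\<close>
  are the generators, and those of degree \<open>2\<close> are sums of two generators of one cone.
\<close>

lemma subtract_generator:
  assumes "x \<in> N" "x \<noteq> 0"
  obtains a where "a \<in> supp (coord x)" "x - a \<in> N" "deg (x - a) = deg x - 1"
    "supp (coord (x - a)) \<subseteq> supp (coord x)"
proof -
  let ?A = "supp (coord x)"
  have A: "?A \<in> K" by (rule coord_supp)
  have "?A \<noteq> {}" using assms(2) lin_coord[of x] by (auto simp: lin_def)
  then obtain a where a: "a \<in> ?A" by auto
  have aV: "a \<in> V" using a A by auto
  have "coord x a \<noteq> 0" "coord x a \<in> \<int>" "0 \<le> coord x a"
    using a assms(1) coord_Ints coord_nonneg by (auto simp: supp_def)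
  then have ge1: "1 \<le> coord x a" by (auto elim!: Ints_cases)
  let ?d = "\<lambda>b. coord x b - coord a b"
  have sa: "supp (coord a) \<subseteq> ?A" using coord_vertex(2)[OF aV] a by simp
  have d: "lin ?d = x - a" "supp ?d \<subseteq> ?A"
    using lin_diff[OF face_finite[OF A] subset_refl sa] by (auto simp: lin_coord)
  have "coord (x - a) = ?d"
    using coord_lin[OF A _ d(2)] d(1) ge1 coord_nonneg by (simp add: coord_vertex(1)[OF aV])
  then have s: "supp (coord (x - a)) \<subseteq> ?A" using d by simp
  have "deg ((x - a) + a) = deg (x - a) + deg a"
    by (rule coord_add(2)[OF A]) (use s sa mem_ccone_iff[OF A] in auto)
  then have "deg (x - a) = deg x - 1" using coord_vertex(3)[OF aV] by simp
  moreover have "x - a \<in> N" using assms(1) vertex_lattice(1)[OF aV] lattice_diff by blast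
  ultimately show thesis using that a s by blast
qed

lemma deg_1_vertex:
  assumes "x \<in> N" "deg x = 1"
  shows "x \<in> V"
proof -
  have "x \<noteq> 0" using assms deg_eq_0_iff[of x] by auto
  then obtain a where "a \<in> supp (coord x)" "deg (x - a) = deg x - 1"
    using subtract_generator[OF assms(1)] by blast
  then show ?thesis using assms deg_eq_0_iff[of "x - a"] coord_supp by auto
qed

lemma deg_less_2_vertex:
  assumes "x \<in> N" "deg x < 2" "x \<noteq> 0"
  shows "x \<in> V"
proof -
  have "deg x \<noteq> 0" "0 \<le> deg x" "deg x \<in> \<int>"
    using assms deg_eq_0_iff deg_nonneg deg_Ints by auto
  then have "deg x = 1" using assms(2) by (auto elim!: Ints_cases)
  then show ?thesis using deg_1_vertex assms by blast
qed

lemma deg_2_sum: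
  assumes "x \<in> N" "deg x = 2"
  obtains g h where "x = g + h" "g \<in> supp (coord x)" "h \<in> supp (coord x)"
proof -
  have "x \<noteq> 0" using assms deg_eq_0_iff[of x] by auto
  then obtain a where a: "a \<in> supp (coord x)" "x - a \<in> N" "deg (x - a) = deg x - 1"
    "supp (coord (x - a)) \<subseteq> supp (coord x)"
    using subtract_generator[OF assms(1)] by blast
  have "x - a \<in> V" using a assms deg_1_vertex by simp
  then have "x - a \<in> supp (coord x)" using a coord_vertex(2) by auto
  then show thesis using that[of a "x - a"] a by simp
qed

lemma vertex_mem_ccone: "v \<in> V \<Longrightarrow> A \<in> K \<Longrightarrow> v \<in> ccone A \<longleftrightarrow> v \<in> A"
  by (simp add: mem_ccone_iff coord_vertex(2))

lemma deg_pair: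
  assumes "{g, h} \<in> K" "0 \<le> s" "0 \<le> t"
  shows "deg (s *\<^sub>R g + t *\<^sub>R h) = s + t" "supp (coord (s *\<^sub>R g + t *\<^sub>R h)) \<subseteq> {g, h}"
proof -
  have c: "s *\<^sub>R g \<in> ccone {g, h}" "t *\<^sub>R h \<in> ccone {g, h}"
    using assms by (simp_all add: convex_cone_hull_mul hull_inc)
  have V: "g \<in> V" "h \<in> V" using assms by auto
  show "deg (s *\<^sub>R g + t *\<^sub>R h) = s + t"
    using coord_add(2)[OF assms(1) c] assms V by (simp add: coord_scale coord_vertex(3))
  show "supp (coord (s *\<^sub>R g + t *\<^sub>R h)) \<subseteq> {g, h}"
    using mem_ccone_iff[OF assms(1)] convex_cone_hull_add[OF c] by blast
qed

lemma supp_pair: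
  assumes "{g, h} \<in> K"
  shows "supp (coord (g + h)) = {g, h}"
proof -
  have V: "g \<in> V" "h \<in> V" using assms by auto
  have "coord (g + h) = (\<lambda>a. coord g a + coord h a)"
    by (rule coord_add(1)[OF assms]) (auto intro: hull_inc)
  then show ?thesis using V by (auto simp: supp_def coord_vertex)
qed

end


section \<open>The degree function of a Fano complex\<close>

text \<open>
  The hyperplane \<open>w \<bullet> x = 1\<close> supports the convex hull of all generators along the simplex \<open>T\<close>. A section
  of a multiple \<open>k\<close> of the anticanonical divisor that comes from a character \<open>u\<close> provides such a \<open>w\<close>,
  namely \<open>- u / k\<close>.
\<close>

locale fano_complex = smooth_complex +
  assumes supporting: "A \<in> K \<Longrightarrow>
    \<exists>w T. T \<in> K \<and> A \<subseteq> T \<and> (\<forall>v\<in>\<Union>K. w \<bullet> v \<le> 1 \<and> (w \<bullet> v = 1 \<longleftrightarrow> v \<in> T))"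
begin

lemma supporting_bound:
  assumes "T \<in> K" "\<forall>v\<in>V. w \<bullet> v \<le> 1 \<and> (w \<bullet> v = 1 \<longleftrightarrow> v \<in> T)"
  shows "w \<bullet> x \<le> deg x" "w \<bullet> x = deg x \<longleftrightarrow> x \<in> ccone T"
proof -
  let ?A = "supp (coord x)"
  have fin: "finite ?A" using coord_supp face_finite by blast
  have V: "a \<in> V" if "a \<in> ?A" for a using that coord_supp by blast
  have "w \<bullet> x = w \<bullet> lin (coord x)" by (simp add: lin_coord)
  also have "\<dots> = (\<Sum>a\<in>?A. coord x a * (w \<bullet> a))"
    by (simp add: lin_def inner_sum_right)
  finally have e: "deg x - w \<bullet> x = (\<Sum>a\<in>?A. coord x a * (1 - w \<bullet> a))"
    by (simp add: deg_def total_def sum_subtractf right_diff_distrib)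
  have nn: "0 \<le> coord x a * (1 - w \<bullet> a)" if "a \<in> ?A" for a
    using assms(2) V[OF that] coord_nonneg by auto
  show "w \<bullet> x \<le> deg x" using e sum_nonneg[of ?A "\<lambda>a. coord x a * (1 - w \<bullet> a)"] nn by simp
  have "w \<bullet> x = deg x \<longleftrightarrow> (\<Sum>a\<in>?A. coord x a * (1 - w \<bullet> a)) = 0" using e by auto
  also have "\<dots> \<longleftrightarrow> (\<forall>a\<in>?A. coord x a * (1 - w \<bullet> a) = 0)"
    using nn fin by (simp add: sum_nonneg_eq_0_iff)
  also have "\<dots> \<longleftrightarrow> (\<forall>a\<in>?A. a \<in> T)"
  proof (rule ball_cong[OF refl])
    fix a assume a: "a \<in> ?A"
    have "w \<bullet> a = 1 \<longleftrightarrow> a \<in> T" using assms(2) V[OF a] by blast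
    then show "coord x a * (1 - w \<bullet> a) = 0 \<longleftrightarrow> a \<in> T" using a by (auto simp: supp_def)
  qed
  finally show "w \<bullet> x = deg x \<longleftrightarrow> x \<in> ccone T"
    using mem_ccone_iff[OF assms(1)] by auto
qed

text \<open>
  Both parts compare the values at \<open>x\<close> and \<open>y\<close> of the form that supports the cone of \<open>x + y\<close>.
\<close>

lemma deg_subadditive: "deg (x + y) \<le> deg x + deg y"
  and deg_additive_common_cone:
    "deg x + deg y \<le> deg (x + y) \<Longrightarrow> \<exists>T\<in>K. x \<in> ccone T \<and> y \<in> ccone T"
proof -
  obtain w T where T: "T \<in> K" "supp (coord (x + y)) \<subseteq> T"
    "\<forall>v\<in>V. w \<bullet> v \<le> 1 \<and> (w \<bullet> v = 1 \<longleftrightarrow> v \<in> T)"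
    using supporting[OF coord_supp[of "x + y"]] by blast
  note b = supporting_bound[OF T(1,3)]
  have "x + y \<in> ccone T" using T mem_ccone_iff by blast
  then have e: "deg (x + y) = w \<bullet> x + w \<bullet> y" using b(2) by (metis inner_add_right)
  then show "deg (x + y) \<le> deg x + deg y" using b(1)[of x] b(1)[of y] by simp
  assume "deg x + deg y \<le> deg (x + y)"
  then have "w \<bullet> x = deg x" "w \<bullet> y = deg y" using e b(1)[of x] b(1)[of y] by auto
  then show "\<exists>T\<in>K. x \<in> ccone T \<and> y \<in> ccone T" using b(2) T by blast
qed

text \<open>
  By strict convexity the degree of the sum is less than \<open>2\<close>.
\<close>

lemma nonface_sum_vertex:
  assumes "g \<in> V" "h \<in> V" "{g, h} \<notin> K" "g + h \<noteq> 0"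
  shows "g + h \<in> V"
proof (rule deg_less_2_vertex)
  show "g + h \<in> N" using assms vertex_lattice lattice_add by blast
  show "deg (g + h) < 2"
  proof (rule ccontr)
    assume "\<not> deg (g + h) < 2"
    then obtain T where "T \<in> K" "g \<in> ccone T" "h \<in> ccone T"
      using deg_additive_common_cone[of g h] assms coord_vertex(3) by auto
    then show False using assms vertex_mem_ccone subset_closed[of T "{g, h}"] by auto
  qed
qed (use assms in auto)

text \<open>
  Degrees add up here, so \<open>g\<close> and \<open>h\<close> lie in a common cone, where coordinates are unique.
\<close>

lemma midpoint_vertex:
  assumes "g \<in> V" "h \<in> V" "k \<in> V" "g + h = 2 *\<^sub>R k"
  shows "g = k"
proof (rule ccontr)
  assume "g \<noteq> k"
  have "deg (g + h) = 2" using assms by (simp add: coord_scale coord_vertex(3))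
  then obtain T where T: "T \<in> K" "g \<in> ccone T" "h \<in> ccone T"
    using deg_additive_common_cone[of g h] assms coord_vertex(3) by auto
  have "coord g g + coord h g = 2 * coord k g"
    using coord_add(1)[OF T] coord_scale(1)[of 2 k] assms(4) by (metis zero_le_numeral)
  then show False using assms \<open>g \<noteq> k\<close> by (auto simp: coord_vertex split: if_splits)
qed

text \<open>
  Two different edges do not meet in interior points, so one of the pairs is not a face.
\<close>

lemma crossing_pairs_vertex:
  assumes "g \<in> V" "h \<in> V" "g' \<in> V" "h' \<in> V" "g + h = g' + h'" "g + h \<noteq> 0" "g \<noteq> g'" "g \<noteq> h'"
  shows "g + h \<in> V"
proof (cases "{g, h} \<in> K \<and> {g', h'} \<in> K")
  case True
  then have "{g, h} = {g', h'}" using supp_pair[of g h] supp_pair[of g' h'] assms(5) by auto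
  then show ?thesis using assms(7,8) by auto
next
  case False
  then show ?thesis using nonface_sum_vertex[of g h] nonface_sum_vertex[of g' h'] assms by auto
qed

text \<open>
  Otherwise \<open>2 g + h\<close> would be a generator, with \<open>g + h\<close> halfway between it and \<open>h\<close>.
\<close>

lemma subdivided_pair_faces:
  assumes "g \<in> V" "h \<in> V" "g + h \<in> V"
  shows "{g, g + h} \<in> K"
proof (rule ccontr)
  assume n: "{g, g + h} \<notin> K"
  have "g + (g + h) \<noteq> 0"
  proof
    assume "g + (g + h) = 0"
    then have h: "h = 2 *\<^sub>R (- g)" by (simp add: algebra_simps scaleR_2 eq_neg_iff_add_eq_0)
    then have "deg h = 2 * deg (- g)" by (simp only: coord_scale(2)[of 2])
    moreover have "- g \<in> N" using lattice_diff[of h "g + h"] assms vertex_lattice(1) by (simp)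
    then have "deg (- g) \<in> \<int>" by (rule deg_Ints)
    ultimately have "1 = 2 * deg (- g)" "deg (- g) \<in> \<int>" using assms coord_vertex(3) by auto
    then obtain z where "1 = 2 * real_of_int z" by (auto elim!: Ints_cases)
    then have "1 = 2 * z" by linarith
    then show False by presburger
  qed
  then have "g + (g + h) \<in> V" using nonface_sum_vertex n assms by blast
  then have "g + (g + h) = g + h"
    using midpoint_vertex[of "g + (g + h)" h "g + h"] assms by (simp add: scaleR_2)
  then show False using vertex_lattice(2)[OF assms(1)] by simp
qed

text \<open>
  The crossing pairs \<open>(a + b) + c = (a + c) + b\<close> and then \<open>a + (a + b + c) = (a + b) + (a + c)\<close> force
  \<open>a + b + c\<close> and \<open>2 a + b + c\<close> to be generators. But \<open>a + c\<close> is the midpoint of \<open>2 a + b + c\<close>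
  and \<open>c - b\<close>. In the application \<open>c - b\<close> is the vertex opposite to \<open>b\<close> across the edge \<open>{a, c}\<close>.
\<close>

lemma no_adjacent_subdivided_edges:
  assumes V: "a \<in> V" "b \<in> V" "c \<in> V" "a + b \<in> V" "a + c \<in> V" "c - b \<in> V"
    and "b \<noteq> c" "c \<noteq> a + b" "b + c \<noteq> 0" "a + b + c \<noteq> 0" "2 *\<^sub>R a + b + c \<noteq> 0"
  shows False
proof -
  have nz: "a \<noteq> 0" "b \<noteq> 0" "c \<noteq> 0" "a + b \<noteq> 0" using V vertex_lattice(2) by auto
  have "(a + b) + c \<in> V"
    using crossing_pairs_vertex[of "a + b" c "a + c" b] V assms nz by (simp add: algebra_simps)
  then have v: "a + b + c \<in> V" by simp
  have "a + (a + b + c) \<in> V"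
  proof (rule crossing_pairs_vertex[of _ _ "a + b" "a + c"])
    show "a + (a + b + c) \<noteq> 0" using assms(11) by (simp add: scaleR_2 algebra_simps)
  qed (use V v nz in \<open>auto simp: algebra_simps\<close>)
  moreover have "(a + (a + b + c)) + (c - b) = 2 *\<^sub>R (a + c)" by (simp add: scaleR_2 algebra_simps)
  ultimately have "a + (a + b + c) = a + c" using midpoint_vertex V by blast
  then show False using nz by (simp add: algebra_simps)
qed

text \<open>
  Adding a large multiple \<open>m\<close> of \<open>p + q\<close> to \<open>r\<close> and to \<open>s\<close> moves the sum into the cone of \<open>p\<close> and \<open>q\<close>,
  where its degree is known. If \<open>\<alpha> + \<beta> \<ge> 2\<close>, then \<open>m + r\<close> and \<open>m + s\<close> must lie in a common cone. Their sum lies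
  in its face \<open>{p, q}\<close>, hence so does \<open>m + r\<close>, contrary to the choice of \<open>r\<close>.
\<close>

lemma wall_relation_face:
  assumes pq: "{p, q} \<in> K" and rs: "r \<in> V" "s \<in> V" "r + s = \<alpha> *\<^sub>R p + \<beta> *\<^sub>R q"
    and r: "r \<notin> span {p, q}"
  shows "\<alpha> + \<beta> < 2"
proof (rule ccontr)
  assume h: "\<not> \<alpha> + \<beta> < 2"
  define M where "M = \<bar>\<alpha>\<bar> + \<bar>\<beta>\<bar>"
  define m where "m = M *\<^sub>R p + M *\<^sub>R q"
  have M: "0 \<le> M" "0 \<le> 2 * M + \<alpha>" "0 \<le> 2 * M + \<beta>" by (auto simp: M_def)
  have dm: "deg m = 2 * M" using deg_pair(1)[OF pq M(1) M(1)] by (simp add: m_def)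
  have sum: "(m + r) + (m + s) = (2 * M + \<alpha>) *\<^sub>R p + (2 * M + \<beta>) *\<^sub>R q"
  proof -
    have "(m + r) + (m + s) = 2 *\<^sub>R m + (r + s)" by (simp add: scaleR_2)
    then show ?thesis unfolding rs(3) by (simp add: m_def algebra_simps)
  qed
  have "deg ((m + r) + (m + s)) = (2 * M + \<alpha>) + (2 * M + \<beta>)"
    unfolding sum by (rule deg_pair(1)[OF pq M(2,3)])
  moreover have "deg (m + r) \<le> 2 * M + 1" "deg (m + s) \<le> 2 * M + 1"
    using deg_subadditive[of m r] deg_subadditive[of m s] dm rs coord_vertex(3) by auto
  ultimately have "deg (m + r) + deg (m + s) \<le> deg ((m + r) + (m + s))" using h by simp
  then obtain T where T: "T \<in> K" "m + r \<in> ccone T" "m + s \<in> ccone T"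
    using deg_additive_common_cone by blast
  have "supp (coord ((m + r) + (m + s))) \<subseteq> {p, q}"
    unfolding sum by (rule deg_pair(2)[OF pq M(2,3)])
  moreover have "supp (coord (m + r)) \<subseteq> supp (coord ((m + r) + (m + s)))"
  proof
    fix a assume "a \<in> supp (coord (m + r))"
    then have "coord (m + r) a > 0" using coord_nonneg[of "m + r" a] by (auto simp: supp_def)
    then have "coord (m + r) a + coord (m + s) a > 0" using coord_nonneg[of "m + s" a] by simp
    then show "a \<in> supp (coord ((m + r) + (m + s)))" by (simp add: coord_add(1)[OF T] supp_def)
  qed
  ultimately have "m + r \<in> ccone {p, q}" using mem_ccone_iff[OF pq] by blast
  then have "m + r \<in> span {p, q}" using ccone_subset_span by blast
  moreover have "m \<in> span {p, q}" unfolding m_def by (intro span_add span_scale span_base) auto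
  ultimately have "r \<in> span {p, q}" using span_diff[of "m + r" "{p, q}" m] by simp
  then show False using r by simp
qed

text \<open>
  If \<open>p + q\<close> subdivides the edge, the previous lemma applies to both halves of the edge and yields
  \<open>\<alpha> < 2\<close> and \<open>\<beta> < 2\<close>.
\<close>

lemma wall_relation:
  assumes V: "p \<in> V" "q \<in> V" "r \<in> V" "s \<in> V"
    and rs: "r + s = of_int \<alpha> *\<^sub>R p + of_int \<beta> *\<^sub>R q"
    and r: "r \<notin> span {p, q}" and pq: "p + q \<noteq> 0"
  shows "\<alpha> + \<beta> \<le> 1 \<or> \<alpha> = 1 \<and> \<beta> = 1 \<and> p + q \<in> V"
proof (cases "{p, q} \<in> K")
  case True
  then have "real_of_int \<alpha> + real_of_int \<beta> < 2" using wall_relation_face V rs r by blast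
  then show ?thesis by linarith
next
  case False
  then have e: "p + q \<in> V" using nonface_sum_vertex V pq by blast
  have sp: "span {p, p + q} \<subseteq> span {p, q}" "span {q, q + p} \<subseteq> span {p, q}"
    by (intro span_minimal; auto intro: span_add span_base)+
  have "{p, p + q} \<in> K" "{q, q + p} \<in> K"
    using subdivided_pair_faces[of p q] subdivided_pair_faces[of q p] V e by (auto simp: add.commute)
  moreover have "r + s = (of_int \<alpha> - of_int \<beta>) *\<^sub>R p + of_int \<beta> *\<^sub>R (p + q)"
    "r + s = (of_int \<beta> - of_int \<alpha>) *\<^sub>R q + of_int \<alpha> *\<^sub>R (q + p)"
    unfolding rs by (simp_all add: algebra_simps)
  ultimately have "(real_of_int \<alpha> - of_int \<beta>) + of_int \<beta> < 2" "(real_of_int \<beta> - of_int \<alpha>) + of_int \<alpha> < 2"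
    using wall_relation_face V r sp by blast+
  then show ?thesis using e by force
qed

end


section \<open>Star subdivisions\<close>

text \<open>
  This is \<open>blow_up\<close> in terms of generator sets; see \<open>blow_up_cones\<close> below.
\<close>

definition star :: "'a::real_vector set set \<Rightarrow> 'a set set \<Rightarrow> 'a set set" where
  "star K S = {A\<in>K. \<forall>T\<in>S. \<not> T \<subseteq> A} \<union>
     {insert (\<Sum>T) A | T A. T \<in> S \<and> A \<in> K \<and> \<not> T \<subseteq> A \<and> A \<union> T \<in> K}"

lemma star_oldI: "\<lbrakk>A \<in> K; \<And>T. T \<in> S \<Longrightarrow> \<not> T \<subseteq> A\<rbrakk> \<Longrightarrow> A \<in> star K S"
  by (simp add: star_def)

lemma star_newI:
  "\<lbrakk>T \<in> S; A \<in> K; \<not> T \<subseteq> A; A \<union> T \<in> K\<rbrakk> \<Longrightarrow> insert (\<Sum>T) A \<in> star K S"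
  unfolding star_def by blast

lemma starE:
  assumes "A \<in> star K S"
  obtains (old) "A \<in> K" "\<And>T. T \<in> S \<Longrightarrow> \<not> T \<subseteq> A"
  | (new) T C where "A = insert (\<Sum>T) C" "T \<in> S" "C \<in> K" "\<not> T \<subseteq> C" "C \<union> T \<in> K"
  using assms unfolding star_def by blast

context smooth_complex
begin

lemma coord_face_sum:
  assumes "A \<in> K"
  shows "coord (\<Sum>A) = (\<lambda>a. if a \<in> A then 1 else 0)" "supp (coord (\<Sum>A)) = A"
    "deg (\<Sum>A) = card A"
proof -
  note fin = face_finite[OF assms]
  show c: "coord (\<Sum>A) = (\<lambda>a. if a \<in> A then 1 else 0)"
    using coord_lin[OF assms _ lin_indicator(2)[OF fin], of 1] lin_indicator(1)[OF fin, of 1] by simp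
  show s: "supp (coord (\<Sum>A)) = A" by (auto simp: c supp_def)
  show "deg (\<Sum>A) = card A" unfolding deg_def total_def s by (simp add: c)
qed

end

locale star_subdivision = smooth_complex +
  fixes S :: "'a set set"
  assumes centers: "S \<subseteq> K"
    and center_card: "T \<in> S \<Longrightarrow> 2 \<le> card T"
    and separated: "\<lbrakk>C \<in> K; T \<in> S; T' \<in> S; T \<subseteq> C; T' \<subseteq> C\<rbrakk> \<Longrightarrow> T = T'"
begin

lemma center_not_vertex:
  assumes "T \<in> S"
  shows "\<Sum>T \<notin> V"
proof
  assume "\<Sum>T \<in> V"
  then have "deg (\<Sum>T) = 1" by (rule coord_vertex(3))
  moreover have "deg (\<Sum>T) = card T" using coord_face_sum(3) assms centers by blast
  ultimately show False using center_card[OF assms] by simp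
qed

text \<open>
  The coordinates of a point in \<open>star K S\<close> in terms of its coordinates \<open>d\<close> in \<open>K\<close>: the largest possible
  multiple of \<open>\<Sum>T\<close> is split off, where \<open>T\<close> is the only center whose star contains the point in its interior.
\<close>

definition push :: "('a \<Rightarrow> real) \<Rightarrow> 'a \<Rightarrow> real" where
  "push d = (if \<exists>T\<in>S. T \<subseteq> supp d
     then let T = (THE T. T \<in> S \<and> T \<subseteq> supp d); m = Min (d ` T)
       in (\<lambda>a. (d a - (if a \<in> T then m else 0)) + (if a = \<Sum>T then m else 0))
     else d)"

lemma push_center:
  assumes "T \<in> S" "T \<subseteq> supp d" "supp d \<in> K"
  shows "push d = (\<lambda>a. (d a - (if a \<in> T then Min (d ` T) else 0)) + (if a = \<Sum>T then Min (d ` T) else 0))"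
proof -
  have "(THE T. T \<in> S \<and> T \<subseteq> supp d) = T"
    using assms separated by (intro the_equality) blast+
  then show ?thesis using assms unfolding push_def Let_def by auto
qed

lemma repr_push:
  assumes "repr K d x"
  shows "repr (star K S) (push d) x"
proof (cases "\<exists>T\<in>S. T \<subseteq> supp d")
  case False
  then show ?thesis using assms by (auto simp: repr_def push_def star_def)
next
  case True
  then obtain T where T: "T \<in> S" "T \<subseteq> supp d" by auto
  have d: "\<And>a. 0 \<le> d a" "supp d \<in> K" "lin d = x" using assms by (auto simp: repr_def)
  define m where "m = Min (d ` T)"
  define e where "e = \<Sum>T"
  have TK: "T \<in> K" using T centers by blast
  have finT: "finite T" using TK by (rule face_finite)
  have ne: "T \<noteq> {}" using center_card[OF T(1)] by auto
  have mmin: "m \<le> d a" if "a \<in> T" for a using that finT by (simp add: m_def)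
  have "m \<in> d ` T" unfolding m_def using finT ne by (intro Min_in) auto
  then obtain t where t: "t \<in> T" "d t = m" by auto
  have m: "0 < m" using t T d(1)[of t] by (auto simp: supp_def)
  have e: "e \<notin> V" unfolding e_def by (rule center_not_vertex[OF T(1)])
  then have eT: "e \<notin> T" "e \<notin> supp d" using TK d(2) by auto
  then have de: "d e = 0" by (simp add: supp_def)
  have p: "push d = (\<lambda>a. (d a - (if a \<in> T then m else 0)) + (if a = e then m else 0))"
    unfolding m_def e_def by (rule push_center[OF T d(2)])
  let ?A = "supp d - {a \<in> T. d a = m}"
  have s: "supp (push d) = insert e ?A"
    using eT de m T(2) by (auto simp: p supp_def)
  have "?A \<in> K" by (rule subset_closed[OF d(2)]) auto
  moreover have "\<not> T \<subseteq> ?A" using t by auto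
  moreover have "?A \<union> T \<in> K" by (rule subset_closed[OF d(2)]) (use T in auto)
  ultimately have "supp (push d) \<in> star K S"
    unfolding s e_def star_def using T(1) by blast
  moreover have "0 \<le> push d a" for a using mmin[of a] m d(1)[of a] by (auto simp: p)
  moreover have "lin (push d) = x"
  proof -
    let ?F = "insert e (supp d)"
    have F: "finite ?F" using d(2) face_finite by simp
    have s1: "supp d \<subseteq> ?F" "supp (\<lambda>a. if a \<in> T then m else 0) \<subseteq> ?F"
      "supp (\<lambda>a. if a = e then m else 0) \<subseteq> ?F" using T(2) by (auto simp: supp_subset supp_def)
    have "lin (push d) = (x - m *\<^sub>R \<Sum>T) + m *\<^sub>R e"
      unfolding p
      by (simp add: lin_add(1)[OF F lin_diff(2)[OF F s1(1,2)] s1(3)] lin_diff(1)[OF F s1(1,2)] d(3)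
        lin_indicator(1)[OF finT] lin_single(1))
    then show ?thesis by (simp add: e_def)
  qed
  ultimately show ?thesis by (simp add: repr_def)
qed

lemma repr_star_push:
  assumes "repr (star K S) c x"
  shows "\<exists>d. repr K d x \<and> push d = c"
proof (cases "supp c \<in> K \<and> (\<forall>T\<in>S. \<not> T \<subseteq> supp c)")
  case True
  then show ?thesis using assms by (intro exI[of _ c]) (auto simp: repr_def push_def)
next
  case False
  have c: "\<And>a. 0 \<le> c a" "supp c \<in> star K S" "lin c = x" using assms by (auto simp: repr_def)
  then obtain T A where T: "T \<in> S" "A \<in> K" "\<not> T \<subseteq> A" "A \<union> T \<in> K" and s: "supp c = insert (\<Sum>T) A"
    using False by (auto simp: star_def)
  define e where "e = \<Sum>T"
  define m where "m = c e"
  have m: "0 < m" using s c(1)[of e] by (auto simp: m_def e_def supp_def less_le)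
  have TK: "T \<in> K" using T centers by blast
  have finT: "finite T" using TK by (rule face_finite)
  have e: "e \<notin> V" unfolding e_def by (rule center_not_vertex[OF T(1)])
  then have eT: "e \<notin> T" "e \<notin> A" using TK T by auto
  define d where "d = (\<lambda>a. (c a - (if a = e then m else 0)) + (if a \<in> T then m else 0))"
  have c0: "c a = 0" if "a \<noteq> e" "a \<notin> A" for a using s that by (auto simp: supp_def e_def)
  have cA: "c a \<noteq> 0" if "a \<in> A" for a using s that by (auto simp: supp_def e_def)
  have sd: "supp d = A \<union> T"
  proof (intro equalityI subsetI)
    fix a assume "a \<in> supp d"
    then have "a \<in> T \<or> a \<noteq> e \<and> c a \<noteq> 0" by (auto simp: supp_def d_def m_def split: if_splits)
    then show "a \<in> A \<union> T" using c0[of a] by blast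
  next
    fix a assume a: "a \<in> A \<union> T"
    then have "a \<noteq> e" using eT by auto
    then show "a \<in> supp d" using a c(1)[of a] m cA[of a] by (auto simp: supp_def d_def)
  qed
  have d0: "0 \<le> d a" for a using c(1)[of a] m by (auto simp: d_def m_def)
  have "lin d = x"
  proof -
    let ?F = "insert e (A \<union> T)"
    have F: "finite ?F" using T(4) face_finite by blast
    have s1: "supp c \<subseteq> ?F" "supp (\<lambda>a. if a \<in> T then m else 0) \<subseteq> ?F"
      "supp (\<lambda>a. if a = e then m else 0) \<subseteq> ?F" using s by (auto simp: supp_subset supp_def e_def)
    have "lin d = (x - m *\<^sub>R e) + m *\<^sub>R \<Sum>T"
      unfolding d_def
      by (simp add: lin_add(1)[OF F lin_diff(2)[OF F s1(1,3)] s1(2)] lin_diff(1)[OF F s1(1,3)] c(3)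
        lin_indicator(1)[OF finT] lin_single(1))
    then show ?thesis by (simp add: e_def)
  qed
  moreover have "push d = c"
  proof -
    obtain t where t: "t \<in> T" "t \<notin> A" using T by auto
    then have "d t = m" using c0[of t] eT by (auto simp: d_def)
    moreover have "m \<le> d a" if "a \<in> T" for a using that eT c(1)[of a] by (auto simp: d_def)
    ultimately have mm: "Min (d ` T) = m" using finT t by (intro Min_eqI) auto
    have "push d = (\<lambda>a. (d a - (if a \<in> T then m else 0)) + (if a = e then m else 0))"
      using push_center[of T d] T sd unfolding mm e_def by simp
    then show ?thesis by (auto simp: d_def)
  qed
  moreover have "supp d \<in> K" using T(4) sd by simp
  ultimately show ?thesis using d0 by (intro exI[of _ d]) (simp add: repr_def)
qed

text \<open>
  The map \<open>push\<close> carries existence and uniqueness of coordinates from \<open>K\<close> to \<open>star K S\<close>.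
\<close>

theorem smooth_complex_star: "smooth_complex N (star K S)"
proof
  have "star K S \<subseteq> K \<union> (\<lambda>(T, A). insert (\<Sum>T) A) ` (S \<times> K)" by (auto simp: star_def)
  moreover have "finite S" using centers finite_complex finite_subset by blast
  ultimately show "finite (star K S)" using finite_complex finite_subset by fastforce
next
  fix A A' assume "A \<in> star K S" "A' \<subseteq> A"
  note sub = \<open>A' \<subseteq> A\<close>
  from \<open>A \<in> star K S\<close> show "A' \<in> star K S"
  proof (cases rule: starE)
    case old
    show ?thesis
    proof (rule star_oldI)
      show "A' \<in> K" using old(1) sub by (rule subset_closed)
      show "\<not> T \<subseteq> A'" if "T \<in> S" for T using old(2)[OF that] sub by blast
    qed
  next
    case 2: (new T C)
    show ?thesis
    proof (cases "\<Sum>T \<in> A'")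
      case True
      have sC: "A' - {\<Sum>T} \<subseteq> C" using 2(1) sub by auto
      have "insert (\<Sum>T) (A' - {\<Sum>T}) \<in> star K S"
      proof (rule star_newI[OF 2(2)])
        show "A' - {\<Sum>T} \<in> K" using 2(3) sC by (rule subset_closed)
        show "\<not> T \<subseteq> A' - {\<Sum>T}" using 2(4) sC by (meson subset_trans)
        show "A' - {\<Sum>T} \<union> T \<in> K" by (rule subset_closed[OF 2(5)]) (use sC in auto)
      qed
      then show ?thesis using True by (simp add: insert_absorb)
    next
      case False
      then have "A' \<subseteq> C" using 2 \<open>A' \<subseteq> A\<close> by auto
      moreover have "\<not> T' \<subseteq> A'" if "T' \<in> S" for T'
        using separated[OF 2(5,2) that] 2(4) \<open>A' \<subseteq> C\<close> by blast
      ultimately show ?thesis using subset_closed[OF 2(3)] by (intro star_oldI) auto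
    qed
  qed
next
  fix A assume "A \<in> star K S"
  then show "\<exists>B. lattice_basis N B \<and> A \<subseteq> B"
  proof (cases rule: starE)
    case old
    then show ?thesis using part_of_basis by blast
  next
    case 2: (new T C)
    then obtain B t where B: "lattice_basis N B" "C \<union> T \<subseteq> B" "t \<in> T" "t \<notin> C"
      using part_of_basis by blast
    then have "lattice_basis N (insert (\<Sum>T) (B - {t}))" by (intro lattice_basis_exchange) auto
    then show ?thesis using 2 B by blast
  qed
next
  fix x
  obtain d where d: "repr K d x" using ex1_repr by blast
  show "\<exists>!c. repr (star K S) c x"
  proof (rule ex1I)
    show "repr (star K S) (push d) x" by (rule repr_push[OF d])
    fix c assume "repr (star K S) c x"
    then show "c = push d" using repr_star_push d ex1_repr by blast
  qed
qed

lemma star_vertices: "\<Union>(star K S) = V \<union> (\<lambda>T. \<Sum>T) ` S"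
proof (intro equalityI subsetI)
  fix v assume "v \<in> \<Union>(star K S)"
  then obtain A where "A \<in> star K S" "v \<in> A" by blast
  then show "v \<in> V \<union> (\<lambda>T. \<Sum>T) ` S" by (elim starE) blast+
next
  fix v assume "v \<in> V \<union> (\<lambda>T. \<Sum>T) ` S"
  then show "v \<in> \<Union>(star K S)"
  proof
    assume v: "v \<in> V"
    have "\<not> T \<subseteq> {v}" if "T \<in> S" for T
      using center_card[OF that] card_mono[of "{v}" T] by auto
    then have "{v} \<in> star K S" by (rule star_oldI[OF vertex_face[OF v]])
    then show ?thesis by blast
  next
    assume "v \<in> (\<lambda>T. \<Sum>T) ` S"
    then obtain T where T: "T \<in> S" "v = \<Sum>T" by auto
    have "\<not> T \<subseteq> {}" using center_card[OF T(1)] by auto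
    then have "insert v {} \<in> star K S"
      unfolding T(2) using T(1) centers empty_face by (intro star_newI) auto
    then show ?thesis by blast
  qed
qed

end


section \<open>Complexes in dimension three\<close>

locale threefold_complex = smooth_complex N K
  for N :: "'a::euclidean_space set" and K +
  assumes dim_3: "DIM('a) = 3"
begin

lemma face_card_le: "A \<in> K \<Longrightarrow> card A \<le> 3"
  using part_of_basis lattice_basis_card lattice_basis_finite card_mono dim_3 by metis

lemma triangle_basis:
  assumes "T \<in> K" "card T = 3"
  shows "lattice_basis N T"
proof -
  obtain B where B: "lattice_basis N B" "T \<subseteq> B" using part_of_basis assms by blast
  then have "T = B"
    using assms lattice_basis_card[OF B(1)] dim_3 lattice_basis_finite[OF B(1)]
    by (intro card_subset_eq) auto
  then show ?thesis using B by simp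
qed

lemma triangle_independent:
  assumes "{p, q, r} \<in> K" "card {p, q, r} = 3" "\<alpha> *\<^sub>R p + \<beta> *\<^sub>R q + \<gamma> *\<^sub>R r = 0"
  shows "\<alpha> = 0" "\<beta> = 0" "\<gamma> = 0"
proof -
  have d: "p \<noteq> q" "p \<noteq> r" "q \<noteq> r" using assms(2) by (auto simp: card_insert_if split: if_splits)
  let ?c = "\<lambda>a. if a = p then \<alpha> else if a = q then \<beta> else if a = r then \<gamma> else 0"
  have s: "supp ?c \<subseteq> {p, q, r}" by (auto simp: supp_subset)
  have "lin ?c = \<alpha> *\<^sub>R p + \<beta> *\<^sub>R q + \<gamma> *\<^sub>R r"
    using d by (auto simp: lin_eq_sum[OF _ s] algebra_simps)
  then have "lin ?c = lin (\<lambda>_. 0)" using assms(3) by (simp add: lin_zero)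
  then have "?c = (\<lambda>_. 0)"
    using lin_inj[OF face_independent[OF assms(1)] s] by (auto simp: supp_subset)
  then have "?c p = 0" "?c q = 0" "?c r = 0" by metis+
  then show "\<alpha> = 0" "\<beta> = 0" "\<gamma> = 0" using d by auto
qed

lemma triangle_notin_span:
  assumes "{p, q, r} \<in> K" "card {p, q, r} = 3"
  shows "r \<notin> span {p, q}"
proof
  have d: "r \<notin> {p, q}" using assms(2) by (auto simp: card_insert_if split: if_splits)
  assume "r \<in> span {p, q}"
  moreover have "{p, q} = {p, q, r} - {r}" using d by auto
  ultimately have "dependent {p, q, r}" unfolding dependent_def by (metis insertCI)
  then show False using face_independent[OF assms(1)] by simp
qed

lemma triangle_expand:
  assumes "{p, q, r} \<in> K" "card {p, q, r} = 3" "x \<in> N"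
  obtains \<alpha> \<beta> \<gamma> :: int where "x = of_int \<alpha> *\<^sub>R p + of_int \<beta> *\<^sub>R q + of_int \<gamma> *\<^sub>R r"
proof -
  have d: "p \<noteq> q" "p \<noteq> r" "q \<noteq> r" using assms(2) by (auto simp: card_insert_if split: if_splits)
  obtain k :: "'a \<Rightarrow> int" where k: "x = (\<Sum>b\<in>{p, q, r}. of_int (k b) *\<^sub>R b)"
    using triangle_basis[OF assms(1,2)] assms(3) by (auto simp: lattice_basis_def)
  show thesis by (rule that[of "k p" "k q" "k r"]) (use k d in \<open>simp add: add.assoc\<close>)
qed

lemma triangle_dual:
  assumes "T \<in> K" "card T = 3"
  obtains u where "\<forall>b\<in>T. u \<bullet> b = of_int (f b)"
  using lattice_basis_dual[OF triangle_basis[OF assms]] by blast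

lemma triangle_dual_coord:
  assumes "T \<in> K" "card T = 3" "b \<in> T"
  shows "\<exists>u. \<forall>c. supp c \<subseteq> T \<longrightarrow> u \<bullet> lin c = c b"
proof -
  obtain u where u: "\<forall>a\<in>T. u \<bullet> a = of_int (if a = b then 1 else 0)"
    using triangle_dual[OF assms(1,2), of "\<lambda>a. if a = b then 1 else 0"] by blast
  have fin: "finite T" using assms face_finite by blast
  have "u \<bullet> lin c = c b" if "supp c \<subseteq> T" for c
  proof -
    have "u \<bullet> lin c = (\<Sum>a\<in>T. c a * (u \<bullet> a))"
      using that fin by (simp add: lin_eq_sum[of T] inner_sum_right)
    also have "\<dots> = (\<Sum>a\<in>T. if a = b then c a else 0)" using u by (intro sum.cong) auto
    finally show ?thesis using fin assms(3) by simp
  qed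
  then show ?thesis by blast
qed

lemma closed_triangle_ccone:
  assumes T: "T \<in> K" "card T = 3"
  shows "closed (ccone T)"
proof -
  obtain u where u: "\<forall>b\<in>T. \<forall>c. supp c \<subseteq> T \<longrightarrow> u b \<bullet> lin c = c b"
    using bchoice[of T "\<lambda>b u. \<forall>c. supp c \<subseteq> T \<longrightarrow> u \<bullet> lin c = c b"] triangle_dual_coord[OF T]
    by blast
  have "ccone T = (\<Inter>b\<in>T. {x. 0 \<le> u b \<bullet> x})"
  proof (intro equalityI subsetI)
    fix x assume "x \<in> ccone T"
    then obtain c where "\<forall>a. 0 \<le> c a" "supp c \<subseteq> T" "lin c = x"
      using ccone_finite[OF face_finite[OF T(1)]] by auto
    then show "x \<in> (\<Inter>b\<in>T. {x. 0 \<le> u b \<bullet> x})" using u by auto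
  next
    fix x assume x: "x \<in> (\<Inter>b\<in>T. {x. 0 \<le> u b \<bullet> x})"
    obtain c where c: "supp c \<subseteq> T" "lin c = x"
      using lattice_basis_lin[OF triangle_basis[OF T]] by blast
    have "0 \<le> c a" for a
    proof (cases "a \<in> T")
      case True
      then have "u a \<bullet> x = c a" using u c by blast
      then show ?thesis using x True by auto
    qed (use c in \<open>auto simp: supp_subset\<close>)
    then show "x \<in> ccone T" using lin_in_ccone[OF face_finite[OF T(1)] _ c(1)] c by auto
  qed
  moreover have "closed {x. 0 \<le> u b \<bullet> x}" for b
    using closed_halfspace_ge[of 0 "u b"] by simp
  ultimately show ?thesis by (simp add: closed_INT)
qed

text \<open>
  The points outside the finitely many closed cones of triangles form an open set. It lies in a finite union
  of proper subspaces, which is negligible, and is therefore empty.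
\<close>

lemma in_triangle: "\<exists>T\<in>K. card T = 3 \<and> x \<in> ccone T"
proof -
  define \<T> where "\<T> = {T\<in>K. card T = 3}"
  define U where "U = - (\<Union>T\<in>\<T>. ccone T)"
  have "finite \<T>" using finite_complex by (simp add: \<T>_def)
  then have "open U" unfolding U_def
    by (intro open_Compl closed_UN) (auto simp: \<T>_def intro: closed_triangle_ccone)
  moreover have "negligible U"
  proof (rule negligible_subset)
    show "negligible (\<Union>A\<in>{A\<in>K. card A \<noteq> 3}. span A)"
    proof (rule negligible_Union)
      show "finite (span ` {A\<in>K. card A \<noteq> 3})" using finite_complex by simp
      fix S assume "S \<in> span ` {A\<in>K. card A \<noteq> 3}"
      then obtain A where A: "A \<in> K" "card A \<noteq> 3" "S = span A" by auto
      have "dim S \<le> card A" using A(3) dim_le_card'[OF face_finite[OF A(1)]] by simp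
      then have "dim S < DIM('a)" using A face_card_le[OF A(1)] dim_3 by linarith
      then show "negligible S" by (rule negligible_lowdim)
    qed
    show "U \<subseteq> (\<Union>A\<in>{A\<in>K. card A \<noteq> 3}. span A)"
    proof
      fix y assume y: "y \<in> U"
      have "y \<in> ccone (supp (coord y))" by (rule mem_own_ccone)
      moreover from this have "card (supp (coord y)) \<noteq> 3"
        using y coord_supp by (auto simp: U_def \<T>_def)
      ultimately show "y \<in> (\<Union>A\<in>{A\<in>K. card A \<noteq> 3}. span A)"
        using coord_supp ccone_subset_span by blast
    qed
  qed
  ultimately have "U = {}" using open_not_negligible by blast
  then have "x \<in> (\<Union>T\<in>\<T>. ccone T)" unfolding U_def by blast
  then show ?thesis by (auto simp: \<T>_def)
qed

lemma face_in_triangle: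
  assumes "A \<in> K"
  obtains T where "T \<in> K" "card T = 3" "A \<subseteq> T"
proof -
  obtain T where T: "T \<in> K" "card T = 3" "\<Sum>A \<in> ccone T" using in_triangle by blast
  then have "A \<subseteq> T" using mem_ccone_iff coord_face_sum(2)[OF assms] by metis
  then show thesis using that T by blast
qed

text \<open>
  Both triangles are lattice bases with \<open>p\<close> and \<open>q\<close> in common, so the coefficient of \<open>r\<close> in \<open>s\<close> is \<open>1\<close> or
  \<open>-1\<close>. If it were \<open>1\<close>, the triangles would lie on the same side of the wall and their cones would overlap.
\<close>

lemma wall_neighbours:
  assumes r: "{p, q, r} \<in> K" "card {p, q, r} = 3" and s: "{p, q, s} \<in> K" "card {p, q, s} = 3"
    and "r \<noteq> s"
  obtains \<alpha> \<beta> :: int where "r + s = of_int \<alpha> *\<^sub>R p + of_int \<beta> *\<^sub>R q"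
proof -
  have sr: "r \<in> V" "s \<in> V" "p \<in> V" "q \<in> V" using UnionI[OF r(1)] UnionI[OF s(1)] by simp_all
  then obtain \<alpha> \<beta> \<gamma> :: int where e: "s = of_int \<alpha> *\<^sub>R p + of_int \<beta> *\<^sub>R q + of_int \<gamma> *\<^sub>R r"
    using triangle_expand[OF r, of s] vertex_lattice(1) by blast
  obtain \<alpha>' \<beta>' \<gamma>' :: int where e': "r = of_int \<alpha>' *\<^sub>R p + of_int \<beta>' *\<^sub>R q + of_int \<gamma>' *\<^sub>R s"
    using triangle_expand[OF s, of r] vertex_lattice(1) sr by blast
  have "(of_int \<alpha>' + of_int \<gamma>' * of_int \<alpha>) *\<^sub>R p + (of_int \<beta>' + of_int \<gamma>' * of_int \<beta>) *\<^sub>R q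
      + (of_int \<gamma>' * of_int \<gamma> - 1) *\<^sub>R r
      = (of_int \<alpha>' *\<^sub>R p + of_int \<beta>' *\<^sub>R q
         + of_int \<gamma>' *\<^sub>R (of_int \<alpha> *\<^sub>R p + of_int \<beta> *\<^sub>R q + of_int \<gamma> *\<^sub>R r)) - r"
    by (simp add: algebra_simps)
  also have "\<dots> = 0" using e e' by simp
  finally have "of_int \<gamma>' * of_int \<gamma> - (1::real) = 0" using triangle_independent(3)[OF r] by blast
  then have "real_of_int (\<gamma>' * \<gamma>) = 1" by simp
  then have "\<gamma>' * \<gamma> = 1" by linarith
  then have "\<gamma> = 1 \<or> \<gamma> = - 1" by (auto simp: zmult_eq_1_iff)
  moreover have "\<gamma> \<noteq> 1"
  proof
    assume "\<gamma> = 1"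
    define y where "y = s + (max 0 (- real_of_int \<alpha>) *\<^sub>R p + max 0 (- real_of_int \<beta>) *\<^sub>R q)"
    have y: "y = r + (max 0 (real_of_int \<alpha>) *\<^sub>R p + max 0 (real_of_int \<beta>) *\<^sub>R q)"
    proof -
      have "max 0 t - max 0 (- t) = t" for t :: real by auto
      then have m: "max 0 t = t + max 0 (- t)" for t :: real by (metis add.commute diff_add_cancel)
      show ?thesis unfolding y_def m[of "real_of_int \<alpha>"] m[of "real_of_int \<beta>"]
        using e \<open>\<gamma> = 1\<close> by (simp add: algebra_simps)
    qed
    have "y \<in> ccone {p, q, r}" unfolding y
      by (intro convex_cone_hull_add convex_cone_hull_mul hull_inc) auto
    then have y1: "supp (coord y) \<subseteq> {p, q, r}" using mem_ccone_iff[OF r(1)] by simp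
    have m2: "s \<in> ccone {p, q, s}"
      "max 0 (- real_of_int \<alpha>) *\<^sub>R p + max 0 (- real_of_int \<beta>) *\<^sub>R q \<in> ccone {p, q, s}"
      by (intro convex_cone_hull_add convex_cone_hull_mul hull_inc; simp)+
    have "coord y s = coord s s + coord (max 0 (- real_of_int \<alpha>) *\<^sub>R p + max 0 (- real_of_int \<beta>) *\<^sub>R q) s"
      unfolding y_def coord_add(1)[OF s(1) m2] ..
    moreover have "coord s s = 1" using coord_vertex(1) sr by simp
    ultimately have "coord y s > 0"
      using coord_nonneg[of "max 0 (- real_of_int \<alpha>) *\<^sub>R p + max 0 (- real_of_int \<beta>) *\<^sub>R q" s] by simp
    then have "s \<in> supp (coord y)" by (simp add: supp_def)
    then have "s \<in> {p, q, r}" using y1 by blast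
    moreover have "s \<noteq> p" "s \<noteq> q" using s(2) by (auto simp: card_insert_if split: if_splits)
    ultimately show False using \<open>r \<noteq> s\<close> by auto
  qed
  ultimately have "\<gamma> = - 1" by simp
  then have "r + s = of_int \<alpha> *\<^sub>R p + of_int \<beta> *\<^sub>R q" using e by simp
  then show thesis by (rule that)
qed

text \<open>
  The cones of the triangles that do not contain the edge \<open>{p, q}\<close> are closed and miss \<open>p + q\<close>. So a point
  slightly behind \<open>p + q\<close>, as seen from \<open>r\<close>, lies in the cone of a triangle on the other side of the edge.
\<close>

lemma across_wall:
  assumes r: "{p, q, r} \<in> K" "card {p, q, r} = 3"
  obtains s where "{p, q, s} \<in> K" "card {p, q, s} = 3" "r \<noteq> s"
proof -
  have pq: "{p, q} \<in> K" by (rule subset_closed[OF r(1)]) auto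
  define C where "C = (\<Union>T\<in>{T\<in>K. card T = 3 \<and> \<not> {p, q} \<subseteq> T}. ccone T)"
  have "closed C"
    unfolding C_def using finite_complex by (intro closed_UN) (auto intro: closed_triangle_ccone)
  moreover have "p + q \<notin> C" using supp_pair[OF pq] mem_ccone_iff by (auto simp: C_def)
  ultimately obtain \<epsilon> where "\<epsilon> > 0" "ball (p + q) \<epsilon> \<subseteq> - C"
    using open_contains_ball[of "- C"] by (auto simp: open_Compl)
  then have \<epsilon>: "\<epsilon> > 0" "ball (p + q) \<epsilon> \<inter> C = {}" by auto
  have nr: "r \<noteq> 0" using vertex_lattice(2)[OF UnionI[OF r(1)]] by simp
  define \<delta> where "\<delta> = \<epsilon> / (2 * norm r)"
  have \<delta>: "\<delta> > 0" using \<epsilon> nr by (simp add: \<delta>_def)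
  define y where "y = p + q - \<delta> *\<^sub>R r"
  have "dist (p + q) y = \<delta> * norm r" using \<delta> by (simp add: y_def dist_norm)
  also have "\<dots> < \<epsilon>" using \<epsilon> nr by (simp add: \<delta>_def)
  finally have "y \<notin> C" using \<epsilon> by auto
  moreover obtain T where T: "T \<in> K" "card T = 3" "y \<in> ccone T" using in_triangle by blast
  ultimately have pqT: "{p, q} \<subseteq> T" by (auto simp: C_def)
  have "p \<noteq> q" using r(2) by (auto simp: card_insert_if split: if_splits)
  then have "card (T - {p, q}) = 1"
    using T pqT face_finite[OF T(1)] by (simp add: card_Diff_subset)
  then obtain s where "T - {p, q} = {s}" by (meson card_1_singletonE)
  then have Ts: "T = {p, q, s}" using pqT by auto
  moreover have "r \<noteq> s"
  proof
    assume "r = s"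
    then obtain c where c: "\<forall>a. 0 \<le> c a" "supp c \<subseteq> {p, q, r}" "lin c = y"
      using T(3) Ts ccone_finite[of "{p, q, r}"] by auto
    have d: "p \<noteq> q" "p \<noteq> r" "q \<noteq> r" using r(2) by (auto simp: card_insert_if split: if_splits)
    have "y = c p *\<^sub>R p + c q *\<^sub>R q + c r *\<^sub>R r"
      using c(3) d by (simp add: lin_eq_sum[OF _ c(2)] add.assoc)
    then have "(c p - 1) *\<^sub>R p + (c q - 1) *\<^sub>R q + (c r + \<delta>) *\<^sub>R r = 0"
      by (simp add: y_def algebra_simps)
    then have "c r + \<delta> = 0" using triangle_independent(3)[OF r] by blast
    then show False using c(1) \<delta> by (metis add_nonneg_pos less_irrefl)
  qed
  ultimately show thesis using that T by blast
qed

text \<open>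
  This passage from local to global convexity is the argument that proves the simplex algorithm correct. If
  \<open>v\<close> lies outside the cone of a triangle, one of its coordinates there is negative, and crossing the
  opposite wall increases the value at \<open>v\<close> of the form \<open>w\<close> that is \<open>1\<close> on the vertices of the
  triangle. So the maximal value is attained at a triangle whose cone contains \<open>v\<close>, and only there.
\<close>

theorem fano_if_convex_walls:
  assumes walls: "\<And>p q r s \<alpha> \<beta>. \<lbrakk>{p, q, r} \<in> K; card {p, q, r} = 3; {p, q, s} \<in> K;
      card {p, q, s} = 3; r \<noteq> s; r + s = of_int \<alpha> *\<^sub>R p + of_int \<beta> *\<^sub>R q\<rbrakk> \<Longrightarrow> \<alpha> + \<beta> \<le> 1"
  shows "fano_complex N K"
proof unfold_locales
  define \<T> where "\<T> = {T\<in>K. card T = 3}"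
  have fin: "finite \<T>" using finite_complex by (simp add: \<T>_def)
  have "\<forall>T\<in>\<T>. \<exists>w. \<forall>b\<in>T. w \<bullet> b = 1"
    using triangle_dual[where f="\<lambda>_. 1"] by (auto simp: \<T>_def) metis
  then obtain w where w: "\<And>T b. T \<in> \<T> \<Longrightarrow> b \<in> T \<Longrightarrow> w T \<bullet> b = 1" by metis
  have improve: "\<exists>T'\<in>\<T>. w T \<bullet> v < w T' \<bullet> v" if T: "T \<in> \<T>" and v: "v \<notin> ccone T" for T v
  proof -
    have TK: "T \<in> K" "card T = 3" using T by (auto simp: \<T>_def)
    obtain c where c: "supp c \<subseteq> T" "lin c = v"
      using lattice_basis_lin[OF triangle_basis[OF TK]] by blast
    obtain r where cr: "c r < 0"
      using v c lin_in_ccone[OF face_finite[OF TK(1)] _ c(1)] by (meson not_le)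
    then have "r \<in> T" using c(1) by (auto simp: supp_def)
    then have "card (T - {r}) = 2" using TK face_finite by simp
    then obtain p q where "T - {r} = {p, q}" "p \<noteq> q" by (meson card_2_iff)
    then have Tp: "T = {p, q, r}" using \<open>r \<in> T\<close> by auto
    have d: "p \<noteq> q" "p \<noteq> r" "q \<noteq> r" using TK(2) Tp by (auto simp: card_insert_if split: if_splits)
    obtain s where s: "{p, q, s} \<in> K" "card {p, q, s} = 3" "r \<noteq> s"
      using across_wall[of p q r] TK Tp by blast
    obtain \<alpha> \<beta> :: int where rs: "r + s = of_int \<alpha> *\<^sub>R p + of_int \<beta> *\<^sub>R q"
      using wall_neighbours[of p q r s] TK s unfolding Tp by blast
    have ab: "\<alpha> + \<beta> \<le> 1" using walls[OF _ _ s rs] TK unfolding Tp by blast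
    have T': "{p, q, s} \<in> \<T>" using s by (simp add: \<T>_def)
    let ?w = "w {p, q, s}"
    have w1: "?w \<bullet> p = 1" "?w \<bullet> q = 1" "?w \<bullet> s = 1" using w[OF T'] by auto
    have w0: "w T \<bullet> p = 1" "w T \<bullet> q = 1" "w T \<bullet> r = 1" using w[OF T] Tp by auto
    have "?w \<bullet> r = ?w \<bullet> (r + s) - 1" using w1 by (simp add: inner_add_right)
    also have "\<dots> = of_int (\<alpha> + \<beta> - 1)" unfolding rs using w1 by (simp add: inner_add_right)
    finally have wr: "?w \<bullet> r \<le> 0" using ab by simp
    have v: "v = c p *\<^sub>R p + c q *\<^sub>R q + c r *\<^sub>R r"
      using c(2) d c(1) unfolding Tp by (simp add: lin_eq_sum[of "{p, q, r}"] add.assoc)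
    have "w T \<bullet> v = c p + c q + c r" using w0 by (simp add: v inner_add_right)
    also have "\<dots> < c p + c q + c r * (?w \<bullet> r)"
    proof -
      have "0 \<le> c r * (?w \<bullet> r)" using cr wr by (simp add: mult_nonpos_nonpos)
      then show ?thesis using cr by linarith
    qed
    also have "\<dots> = ?w \<bullet> v" using w1 by (simp add: v inner_add_right)
    finally show ?thesis using T' by blast
  qed
  have bound: "w T \<bullet> v \<le> 1" if T: "T \<in> \<T>" and v: "v \<in> V" for T v
  proof -
    define m where "m = Max ((\<lambda>T. w T \<bullet> v) ` \<T>)"
    have "m \<in> (\<lambda>T. w T \<bullet> v) ` \<T>" unfolding m_def using fin T by (intro Max_in) auto
    then obtain T0 where T0: "T0 \<in> \<T>" "w T0 \<bullet> v = m" by auto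
    have max: "w T \<bullet> v \<le> m" if "T \<in> \<T>" for T unfolding m_def using fin that by auto
    have "v \<in> ccone T0" using improve[OF T0(1), of v] max T0(2) by (meson not_le)
    then have "v \<in> T0" using vertex_mem_ccone[OF v] T0(1) by (simp add: \<T>_def)
    then have "m = 1" using w T0 by auto
    then show ?thesis using max T by simp
  qed
  fix A assume "A \<in> K"
  then obtain T where T: "T \<in> K" "card T = 3" "A \<subseteq> T" using face_in_triangle by blast
  then have TT: "T \<in> \<T>" by (simp add: \<T>_def)
  have "w T \<bullet> v = 1 \<longleftrightarrow> v \<in> T" if v: "v \<in> V" for v
  proof
    assume "w T \<bullet> v = 1"
    then have "\<not> (\<exists>T'\<in>\<T>. w T \<bullet> v < w T' \<bullet> v)" using bound v by fastforce
    then have "v \<in> ccone T" using improve[OF TT] by blast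
    then show "v \<in> T" using vertex_mem_ccone[OF v T(1)] by simp
  qed (use w TT in auto)
  then show "\<exists>w T. T \<in> K \<and> A \<subseteq> T \<and> (\<forall>v\<in>V. w \<bullet> v \<le> 1 \<and> (w \<bullet> v = 1 \<longleftrightarrow> v \<in> T))"
    using T TT bound by blast
qed

end

text \<open>A converse of \<open>fano_if_convex_walls\<close>, because \<open>wall_relation_face\<close> applies to the edge of the wall.\<close>

lemma (in fano_complex) convex_wall:
  assumes "DIM('a) = 3"
    and r: "{p, q, r} \<in> K" "card {p, q, r} = 3" and s: "{p, q, s} \<in> K" "card {p, q, s} = 3" and "r \<noteq> s"
    and rs: "r + s = \<alpha> *\<^sub>R p + \<beta> *\<^sub>R q"
  shows "\<alpha> + \<beta> < 2"
proof -
  interpret threefold_complex N K by unfold_locales (rule assms(1))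
  have V: "r \<in> V" "s \<in> V" using UnionI[OF r(1)] UnionI[OF s(1)] by simp_all
  show ?thesis
    using wall_relation_face[of p q r s \<alpha> \<beta>] subset_closed[OF r(1), of "{p, q}"] V rs
      triangle_notin_span[OF r] by auto
qed


section \<open>Complexes whose generators are among those of a Fano complex\<close>

text \<open>
  Only the generators are compared. In dimension three this already makes \<open>L\<close> a refinement of \<open>K\<close>, as
  the lemma \<open>refines\<close> below shows.
\<close>

locale coarser_complex = threefold_complex N K + fine: fano_complex N L
  for N :: "'a::euclidean_space set" and K L +
  assumes vertices: "\<Union>K \<subseteq> \<Union>L"
begin

lemma face_vertices: "A \<in> K \<Longrightarrow> a \<in> A \<Longrightarrow> a \<in> \<Union>L"
  using vertices by blast

text \<open>
  The edge is a face of \<open>L\<close> or consists of two faces of \<open>L\<close> that meet in \<open>p + q\<close>.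
\<close>

lemma refines_pair:
  assumes pq: "{p, q} \<in> K" and x: "x \<in> ccone {p, q}"
  shows "supp (fine.coord x) \<subseteq> ccone {p, q}"
proof -
  have V: "p \<in> \<Union>L" "q \<in> \<Union>L" using pq vertices by auto
  obtain \<alpha> \<beta> where ab: "0 \<le> \<alpha>" "0 \<le> \<beta>" "x = \<alpha> *\<^sub>R p + \<beta> *\<^sub>R q"
  proof (cases "p = q")
    case True
    obtain c where "\<forall>a. 0 \<le> c a" "supp c \<subseteq> {p}" "lin c = x"
      using x True ccone_finite[of "{p}"] by auto
    then show thesis using that[of "c p" 0] by (simp add: lin_eq_sum[of "{p}"])
  next
    case False
    obtain c where "\<forall>a. 0 \<le> c a" "supp c \<subseteq> {p, q}" "lin c = x"
      using x ccone_finite[of "{p, q}"] by auto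
    then show thesis using that[of "c p" "c q"] False by (simp add: lin_eq_sum[of "{p, q}"])
  qed
  show ?thesis
  proof (cases "{p, q} \<in> L")
    case True
    then show ?thesis using fine.deg_pair(2)[OF True ab(1,2)] ab(3) hull_subset[of "{p, q}" convex_cone] by auto
  next
    case False
    have "p \<noteq> q" using False fine.vertex_face[OF V(1)] by auto
    have "p + q \<noteq> 0"
      using supp_pair[OF pq] coord_face_sum(2)[OF empty_face] by auto
    then have e: "p + q \<in> \<Union>L" using fine.nonface_sum_vertex False V by blast
    have c: "p + q \<in> ccone {p, q}" "p \<in> ccone {p, q}" "q \<in> ccone {p, q}"
      by (intro convex_cone_hull_add hull_inc; simp)+
    show ?thesis
    proof (cases "\<beta> \<le> \<alpha>")
      case True
      have "{p, p + q} \<in> L" using fine.subdivided_pair_faces V e by blast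
      moreover have "x = (\<alpha> - \<beta>) *\<^sub>R p + \<beta> *\<^sub>R (p + q)" by (simp add: ab(3) algebra_simps)
      ultimately show ?thesis using fine.deg_pair(2)[of p "p + q" "\<alpha> - \<beta>" \<beta>] True ab c by auto
    next
      case False
      have "{q, q + p} \<in> L" using fine.subdivided_pair_faces[of q p] V e by (simp add: add.commute)
      moreover have "x = (\<beta> - \<alpha>) *\<^sub>R q + \<alpha> *\<^sub>R (q + p)" by (simp add: ab(3) algebra_simps)
      ultimately show ?thesis using fine.deg_pair(2)[of q "q + p" "\<beta> - \<alpha>" \<alpha>] False ab c
        by (auto simp: add.commute)
    qed
  qed
qed

text \<open>
  Suppose that \<open>A\<close> is a triangle and that a generator \<open>b\<close> of the cone of \<open>L\<close> around \<open>x\<close> lies outside the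
  cone of \<open>A\<close>. The segment from \<open>x\<close> to \<open>b\<close> leaves the cone of \<open>A\<close> at a point \<open>y\<close> in the cone of an
  edge. The point \<open>y\<close> still has a positive coordinate at \<open>b\<close>, so the case of edges puts \<open>b\<close> into
  the cone of this edge.
\<close>

lemma refines:
  assumes A: "A \<in> K" and x: "x \<in> ccone A"
  shows "supp (fine.coord x) \<subseteq> ccone A"
proof -
  have small: "supp (fine.coord x) \<subseteq> ccone A" if A: "A \<in> K" "card A \<le> 2" "x \<in> ccone A" for A x
  proof -
    have fin: "finite A" using A face_finite by blast
    consider "card A = 0" | "card A = 1" | "card A = 2" using A(2) by linarith
    then show ?thesis
    proof cases
      case 1
      then have "A = {}" using fin by simp
      then have "supp (fine.coord x) \<subseteq> {}" using A(3) fine.mem_ccone_iff[OF fine.empty_face] by simp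
      then show ?thesis by simp
    next
      case 2
      then obtain p where "A = {p}" by (meson card_1_singletonE)
      then show ?thesis using refines_pair[of p p] A by simp
    next
      case 3
      then obtain p q where "A = {p, q}" by (meson card_2_iff)
      then show ?thesis using refines_pair A by simp
    qed
  qed
  show ?thesis
  proof (cases "card A \<le> 2")
    case True
    then show ?thesis using small A x by blast
  next
    case False
    then have A3: "card A = 3" using face_card_le[OF A] by simp
    have fin: "finite A" using A face_finite by blast
    show ?thesis
    proof
      fix b assume b: "b \<in> supp (fine.coord x)"
      show "b \<in> ccone A"
      proof (rule ccontr)
        assume nb: "b \<notin> ccone A"
        define \<xi> where "\<xi> = coord x"
        have \<xi>: "\<And>a. 0 \<le> \<xi> a" "supp \<xi> \<subseteq> A" "lin \<xi> = x"
          using coord_nonneg mem_ccone_iff[OF A] x lin_coord by (auto simp: \<xi>_def)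
        obtain \<eta> where \<eta>: "supp \<eta> \<subseteq> A" "lin \<eta> = b"
          using lattice_basis_lin[OF triangle_basis[OF A A3]] by blast
        \<comment> \<open>The coordinate of \<open>(1 - t) x + t b\<close> at \<open>a \<in> D\<close> vanishes for \<open>t = \<tau> a\<close>; the smallest such \<open>t\<close> is the exit.\<close>
        define D where "D = {a\<in>A. \<eta> a < 0}"
        have "\<exists>a. \<eta> a < 0" using nb lin_in_ccone[OF fin _ \<eta>(1)] \<eta>(2) by (meson not_le)
        then have D: "D \<noteq> {}" "finite D" using \<eta>(1) fin by (force simp: D_def supp_def)+
        define \<tau> where "\<tau> = (\<lambda>a. \<xi> a / (\<xi> a - \<eta> a))"
        define t where "t = Min (\<tau> ` D)"
        have "t \<in> \<tau> ` D" unfolding t_def using D by (intro Min_in) auto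
        then obtain a0 where a0: "a0 \<in> D" "t = \<tau> a0" by auto
        have tmin: "t \<le> \<tau> a" if "a \<in> D" for a unfolding t_def using D that by auto
        have pos: "0 < \<xi> a - \<eta> a" if "a \<in> D" for a using \<xi>(1)[of a] that by (simp add: D_def)
        have t: "0 \<le> t" "t < 1"
          using pos[OF a0(1)] \<xi>(1)[of a0] a0 by (auto simp: \<tau>_def D_def divide_less_eq)
        define \<zeta> where "\<zeta> = (\<lambda>a. (1 - t) * \<xi> a + t * \<eta> a)"
        define y where "y = (1 - t) *\<^sub>R x + t *\<^sub>R b"
        have \<zeta>l: "lin \<zeta> = y" "supp \<zeta> \<subseteq> A"
          unfolding \<zeta>_def y_def
          using lin_add[OF fin lin_scale(3)[OF fin \<xi>(2)] lin_scale(3)[OF fin \<eta>(1)]]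
            lin_scale(1)[OF fin \<xi>(2)] lin_scale(1)[OF fin \<eta>(1)] \<xi>(3) \<eta>(2) by auto
        have \<zeta>0: "0 \<le> \<zeta> a" for a
        proof (cases "a \<in> D")
          case True
          have "t * (\<xi> a - \<eta> a) \<le> \<xi> a"
            using tmin[OF True] pos[OF True] by (simp add: \<tau>_def pos_le_divide_eq)
          then show ?thesis by (simp add: \<zeta>_def algebra_simps)
        next
          case False
          then have "0 \<le> \<eta> a" using \<eta>(1) by (auto simp: D_def supp_subset not_less)
          then show ?thesis using \<xi>(1)[of a] t by (simp add: \<zeta>_def)
        qed
        have "t * (\<xi> a0 - \<eta> a0) = \<xi> a0" using pos[OF a0(1)] by (simp add: a0(2) \<tau>_def)
        then have "\<zeta> a0 = 0" by (simp add: \<zeta>_def algebra_simps)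
        then have s: "supp \<zeta> \<subseteq> A - {a0}" using \<zeta>l(2) by (auto simp: supp_def)
        have yA: "y \<in> ccone (A - {a0})"
          using lin_in_ccone[of "A - {a0}" \<zeta>] fin \<zeta>0 s \<zeta>l(1) by auto
        have "card (A - {a0}) \<le> 2" using A3 a0(1) fin by (simp add: D_def)
        then have "supp (fine.coord y) \<subseteq> ccone (A - {a0})"
          using small[OF subset_closed[OF A, of "A - {a0}"]] yA by blast
        moreover have "b \<in> supp (fine.coord y)"
        proof -
          have bL: "b \<in> \<Union>L" using b fine.coord_supp by blast
          let ?B = "supp (fine.coord x)"
          have "(1 - t) *\<^sub>R x \<in> ccone ?B" "t *\<^sub>R b \<in> ccone ?B"
            using t b by (simp_all add: convex_cone_hull_mul hull_inc fine.mem_own_ccone)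
          then have "fine.coord y b = (1 - t) * fine.coord x b + t * fine.coord b b"
            using fine.coord_add(1)[OF fine.coord_supp[of x], of "(1 - t) *\<^sub>R x" "t *\<^sub>R b"] t
            by (simp add: y_def fine.coord_scale(1))
          moreover have "fine.coord x b > 0"
            using b fine.coord_nonneg[of x b] by (auto simp: supp_def)
          ultimately have "fine.coord y b > 0"
            using t fine.coord_vertex(1)[OF bL] by (simp add: add_pos_nonneg)
          then show ?thesis by (simp add: supp_def)
        qed
        ultimately have "b \<in> ccone (A - {a0})" by blast
        then show False using nb hull_mono[of "A - {a0}" A convex_cone] by blast
      qed
    qed
  qed
qed

text \<open>
  The excluded walls \<open>r + s = p + q\<close> are those of curves with normal bundle \<open>O(-1) \<oplus> O(-1)\<close>, the centers
  of the simplest flops. By \<open>wall_relation\<close> every other wall is strictly convex.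
\<close>

theorem fano_if_no_flopping_wall:
  assumes "\<And>p q r s. \<lbrakk>{p, q, r} \<in> K; card {p, q, r} = 3; {p, q, s} \<in> K; card {p, q, s} = 3; r \<noteq> s;
    r + s = p + q; p + q \<in> \<Union>L\<rbrakk> \<Longrightarrow> False"
  shows "fano_complex N K"
proof (rule fano_if_convex_walls)
  fix p q r s and \<alpha> \<beta> :: int
  assume r: "{p, q, r} \<in> K" "card {p, q, r} = 3" and s: "{p, q, s} \<in> K" "card {p, q, s} = 3"
    and rs: "r \<noteq> s" "r + s = of_int \<alpha> *\<^sub>R p + of_int \<beta> *\<^sub>R q"
  have V: "p \<in> \<Union>L" "q \<in> \<Union>L" "r \<in> \<Union>L" "s \<in> \<Union>L"
    using face_vertices[OF r(1)] face_vertices[OF s(1)] by simp_all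
  have "p + q \<noteq> 0" using triangle_independent(1)[OF r, of 1 1 0] by auto
  then have "\<alpha> + \<beta> \<le> 1 \<or> \<alpha> = 1 \<and> \<beta> = 1 \<and> p + q \<in> \<Union>L"
    using fine.wall_relation[OF V rs(2) triangle_notin_span[OF r]] by blast
  moreover have "\<not> (\<alpha> = 1 \<and> \<beta> = 1 \<and> p + q \<in> \<Union>L)"
  proof
    assume h: "\<alpha> = 1 \<and> \<beta> = 1 \<and> p + q \<in> \<Union>L"
    then have "r + s = p + q" using rs(2) by simp
    then show False using assms[OF r s rs(1)] h by blast
  qed
  ultimately show "\<alpha> + \<beta> \<le> 1" by blast
qed

text \<open>
  The degrees of \<open>p\<close> and of \<open>q + r\<close> add up, so both points lie in a common cone of \<open>L\<close>.
\<close>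

lemma triangle_in_fine:
  assumes pq: "{p, q, r} \<in> K" "card {p, q, r} = 3"
    and edges: "{q, r} \<in> L" and deg: "fine.deg (p + q + r) = 3"
  shows "{p, q, r} \<in> L"
proof -
  have V: "p \<in> \<Union>L" using face_vertices[OF pq(1)] by simp
  have "fine.deg p + fine.deg (q + r) \<le> fine.deg (p + (q + r))"
    using deg fine.coord_vertex(3)[OF V] fine.deg_pair(1)[OF edges, of 1 1] by (simp add: add.assoc)
  then obtain T where T: "T \<in> L" "p \<in> ccone T" "q + r \<in> ccone T"
    using fine.deg_additive_common_cone by blast
  have "p \<in> T" using T V fine.vertex_mem_ccone by blast
  moreover have "{q, r} \<subseteq> T" using T fine.mem_ccone_iff[OF T(1)] fine.supp_pair[OF edges] by metis
  ultimately show ?thesis using fine.subset_closed[OF T(1), of "{p, q, r}"] by simp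
qed

text \<open>
  At every vertex the coordinates of \<open>g\<close> and \<open>h\<close> are nonnegative integers with sum \<open>1\<close>. So \<open>g\<close> and \<open>h\<close> are
  the sums of two complementary nonempty subsets of \<open>A\<close>, one of which has two elements.
\<close>

lemma sum_of_two_in_triangle:
  assumes A: "A \<in> K" "card A = 3" and g: "g \<in> N" "g \<in> ccone A" "g \<noteq> 0"
    and h: "h \<in> N" "h \<in> ccone A" "h \<noteq> 0" and sum: "g + h = \<Sum>A"
  obtains p q where "p \<in> A" "q \<in> A" "p \<noteq> q" "p + q = g \<or> p + q = h"
proof -
  have fin: "finite A" using A face_finite by blast
  have c: "coord g a + coord h a = (if a \<in> A then 1 else 0)" for a
    using coord_add(1)[OF A(1) g(2) h(2)] coord_face_sum(1)[OF A(1)] sum by metis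
  have "coord g a = 0 \<or> coord g a = 1" for a
  proof -
    have "coord g a \<in> \<int>" "0 \<le> coord g a" "coord g a \<le> 1"
      using coord_Ints[OF g(1)] coord_nonneg[of g a] coord_nonneg[of h a] c[of a]
      by (auto split: if_splits)
    then show ?thesis by (auto elim!: Ints_cases)
  qed
  note g01 = this
  have supp_in: "supp (coord g) \<subseteq> A" "supp (coord h) \<subseteq> A" using g h A mem_ccone_iff by auto
  have gs: "g = \<Sum>(supp (coord g))"
  proof -
    have "g = (\<Sum>a\<in>supp (coord g). coord g a *\<^sub>R a)" using lin_coord[of g] by (simp add: lin_def)
    also have "\<dots> = \<Sum>(supp (coord g))"
      by (rule sum.cong) (use g01 in \<open>force simp: supp_def\<close>)+
    finally show ?thesis .
  qed
  have hs: "h = \<Sum>(supp (coord h))"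
  proof -
    have h01: "coord h a = 0 \<or> coord h a = 1" for a
      using g01[of a] c[of a] coord_nonneg[of h a] by (auto split: if_splits)
    have "h = (\<Sum>a\<in>supp (coord h). coord h a *\<^sub>R a)" using lin_coord[of h] by (simp add: lin_def)
    also have "\<dots> = \<Sum>(supp (coord h))"
      by (rule sum.cong) (use h01 in \<open>force simp: supp_def\<close>)+
    finally show ?thesis .
  qed
  have hd: "supp (coord h) = A - supp (coord g)"
  proof (intro equalityI subsetI)
    fix a assume a: "a \<in> supp (coord h)"
    then have "a \<in> A" using supp_in by blast
    then show "a \<in> A - supp (coord g)" using a c[of a] g01[of a] by (auto simp: supp_def)
  next
    fix a assume a: "a \<in> A - supp (coord g)"
    then show "a \<in> supp (coord h)" using c[of a] by (auto simp: supp_def)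
  qed
  have "supp (coord g) \<noteq> {}" "supp (coord h) \<noteq> {}" using gs hs g(3) h(3) by auto
  then have "0 < card (supp (coord g))" "0 < card (supp (coord h))"
    using supp_in fin finite_subset by (auto simp: card_gt_0_iff)
  moreover have "card (supp (coord h)) = 3 - card (supp (coord g))"
    using hd A supp_in fin by (simp add: card_Diff_subset finite_subset)
  ultimately have "card (supp (coord g)) = 2 \<or> card (supp (coord h)) = 2" by linarith
  then obtain p q where "p \<noteq> q" "supp (coord g) = {p, q} \<or> supp (coord h) = {p, q}"
    by (metis card_2_iff)
  then show thesis
    using that[of p q] gs hs supp_in by auto
qed

text \<open>
  For a triangle whose edges are not subdivided the degree of \<open>p + q + r\<close> in the fine complex
  decides: it is \<open>3\<close> if the triangle is a face there, and \<open>1\<close> if \<open>p + q + r\<close> is a generator.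
  Degree \<open>2\<close> would write it as a sum of two lattice points of the cone, one of which is the sum
  of the end points of an edge.
\<close>

theorem unsubdivided_eq:
  assumes edges: "\<And>p q. \<lbrakk>{p, q} \<in> K; p \<noteq> q\<rbrakk> \<Longrightarrow> p + q \<notin> \<Union>L"
    and triangles: "\<And>T. \<lbrakk>T \<in> K; card T = 3\<rbrakk> \<Longrightarrow> \<Sum>T \<notin> \<Union>L"
  shows "K = L"
proof -
  have edge: "{p, q} \<in> L" if pq: "{p, q} \<in> K" for p q
  proof (cases "p = q")
    case True
    then show ?thesis using pq vertices fine.vertex_face[of p] by auto
  next
    case False
    have "p + q \<noteq> 0" using supp_pair[OF pq] coord_face_sum(2)[OF empty_face] by auto
    moreover have "p \<in> \<Union>L" "q \<in> \<Union>L" using pq vertices by auto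
    ultimately show ?thesis using fine.nonface_sum_vertex edges[OF pq False] by blast
  qed
  have sub: "A \<in> L" if A: "A \<in> K" for A
  proof -
    have fin: "finite A" using A face_finite by blast
    consider "card A = 0" | "card A = 1" | "card A = 2" | "card A = 3"
      using face_card_le[OF A] by linarith
    then show ?thesis
    proof cases
      case 1
      then show ?thesis using fin fine.empty_face by simp
    next
      case 2
      then obtain p where "A = {p}" by (meson card_1_singletonE)
      then show ?thesis using edge[of p p] A by simp
    next
      case 3
      then obtain p q where "A = {p, q}" by (meson card_2_iff)
      then show ?thesis using edge A by simp
    next
      case 4
      then obtain p q r where Ap: "A = {p, q, r}" and d: "p \<noteq> q" "q \<noteq> r" "p \<noteq> r"
        by (metis card_3_iff)
      have sumA: "\<Sum>A = p + q + r" using d by (simp add: Ap add.assoc)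
      have AV: "A \<subseteq> \<Union>L" using A vertices by blast
      have AN: "\<Sum>A \<in> N" using A vertex_lattice(1) fin lattice_sum some_basis by (metis UnionI subsetI)
      have qr: "{q, r} \<in> L" using edge[of q r] subset_closed[OF A, of "{q, r}"] Ap by auto
      have "fine.deg (\<Sum>A) \<le> 3"
        using fine.deg_subadditive[of p "q + r"] fine.deg_pair(1)[OF qr, of 1 1]
          fine.coord_vertex(3)[of p] AV Ap sumA by (simp add: add.assoc)
      moreover have "fine.deg (\<Sum>A) \<in> \<int>" using fine.deg_Ints[OF AN] .
      moreover have "\<not> fine.deg (\<Sum>A) < 2"
      proof -
        have "\<Sum>A \<noteq> 0" using triangle_independent(1)[of p q r 1 1 1] A 4 Ap sumA by auto
        then show ?thesis using fine.deg_less_2_vertex[OF AN] triangles[OF A 4] by blast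
      qed
      moreover have "fine.deg (\<Sum>A) \<noteq> 2"
      proof
        assume "fine.deg (\<Sum>A) = 2"
        then obtain g h where gh: "\<Sum>A = g + h" "g \<in> supp (fine.coord (\<Sum>A))" "h \<in> supp (fine.coord (\<Sum>A))"
          using fine.deg_2_sum[OF AN] by blast
        have "\<Sum>A \<in> ccone A" using mem_ccone_iff[OF A] coord_face_sum(2)[OF A] by simp
        then have inA: "g \<in> ccone A" "h \<in> ccone A" using refines[OF A] gh by auto
        have ghV: "g \<in> \<Union>L" "h \<in> \<Union>L" using gh fine.coord_supp by blast+
        obtain u v where uv: "u \<in> A" "v \<in> A" "u \<noteq> v" "u + v = g \<or> u + v = h"
          using sum_of_two_in_triangle[OF A 4 _ inA(1) _ _ inA(2)] gh(1)
            fine.vertex_lattice[OF ghV(1)] fine.vertex_lattice[OF ghV(2)] by metis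
        then have "{u, v} \<in> K" using subset_closed[OF A, of "{u, v}"] by simp
        then show False using edges[of u v] uv ghV by auto
      qed
      ultimately have "fine.deg (p + q + r) = 3" unfolding sumA by (auto elim!: Ints_cases)
      then show ?thesis using triangle_in_fine[of p q r] A 4 qr Ap by simp
    qed
  qed
  show "K = L"
  proof (intro equalityI subsetI)
    fix B assume B: "B \<in> L"
    have "repr L (coord (\<Sum>B)) (\<Sum>B)" using repr_coord[of "\<Sum>B"] sub by (simp add: repr_def)
    then have "fine.coord (\<Sum>B) = coord (\<Sum>B)" by (rule fine.coord_unique)
    then show "B \<in> K" using fine.coord_face_sum(2)[OF B] coord_supp[of "\<Sum>B"] by simp
  qed (rule sub)
qed

end


section \<open>Translation between fans and complexes\<close>

context smooth_complex
begin

lemma cone_faces_face: "A \<in> K \<Longrightarrow> cone_faces (ccone A) = ccone ` Pow A"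
  by (rule cone_faces_ccone[OF face_independent])

lemma cone_gens_face:
  assumes "A \<in> K"
  shows "cone_gens N (ccone A) = A"
proof -
  obtain B where "lattice_basis N B" "A \<subseteq> B" using part_of_basis[OF assms] by blast
  then show ?thesis by (rule cone_gens_ccone)
qed

lemma ccone_eq_iff: "A \<in> K \<Longrightarrow> B \<in> K \<Longrightarrow> ccone A = ccone B \<longleftrightarrow> A = B"
  using cone_gens_face by metis

lemma ccone_mem_faces_iff:
  assumes "A \<in> K" "T \<in> K"
  shows "ccone T \<in> cone_faces (ccone A) \<longleftrightarrow> T \<subseteq> A"
proof
  assume "ccone T \<in> cone_faces (ccone A)"
  then obtain B where B: "B \<subseteq> A" "ccone T = ccone B" using cone_faces_face assms by auto
  moreover have "B \<in> K" using subset_closed assms(1) B(1) by blast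
  ultimately show "T \<subseteq> A" using ccone_eq_iff[OF assms(2)] by blast
next
  assume "T \<subseteq> A"
  then show "ccone T \<in> cone_faces (ccone A)" using cone_faces_face assms by auto
qed

lemma ccone_Int:
  assumes "A \<in> K" "B \<in> K"
  shows "ccone A \<inter> ccone B = ccone (A \<inter> B)"
proof -
  have "A \<inter> B \<in> K" using subset_closed assms by blast
  then show ?thesis using assms mem_ccone_iff by auto
qed

lemma fan_gens_cones: "fan_gens N (ccone ` K) = V"
proof (intro equalityI subsetI)
  fix v assume "v \<in> fan_gens N (ccone ` K)"
  then obtain A where v: "primitive_vector N v" "A \<in> K" "ccone {v} = ccone A"
    by (auto simp: fan_gens_def)
  have "ccone A \<in> cone_faces (ccone A)" using ccone_mem_faces_iff v(2) by blast
  then have "v \<in> cone_gens N (ccone A)" using v by (simp add: cone_gens_def)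
  then show "v \<in> V" using cone_gens_face v by blast
next
  fix v assume "v \<in> V"
  then show "v \<in> fan_gens N (ccone ` K)"
    using vertex_lattice(3) vertex_face by (auto simp: fan_gens_def)
qed

lemma fan_cones: "fan N (ccone ` K)"
  unfolding fan_def
proof (intro conjI ballI)
  show "finite (ccone ` K)" using finite_complex by simp
  show "ccone ` K \<noteq> {}" using empty_face by blast
next
  fix \<sigma> assume "\<sigma> \<in> ccone ` K"
  then obtain A where A: "A \<in> K" "\<sigma> = ccone A" by auto
  have "A \<subseteq> N" using vertex_lattice(1) A by blast
  moreover have "\<sigma> \<inter> uminus ` \<sigma> \<subseteq> {0}"
  proof
    fix x assume "x \<in> \<sigma> \<inter> uminus ` \<sigma>"
    then have "x \<in> ccone A" "- x \<in> ccone A" using A by auto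
    then have "deg x + deg (- x) = 0" using coord_add(2)[OF A(1), of x "- x"] deg_eq_0_iff[of 0] by simp
    then have "deg x = 0" using deg_nonneg[of x] deg_nonneg[of "- x"] by linarith
    then show "x \<in> {0}" using deg_eq_0_iff by simp
  qed
  moreover have "0 \<in> \<sigma> \<inter> uminus ` \<sigma>"
    using A convex_cone_hull_contains_0[of A] by (auto intro!: image_eqI[of 0 uminus 0])
  ultimately show "strongly_convex_rational_cone N \<sigma>"
    unfolding strongly_convex_rational_cone_def using A face_finite by blast
  show "cone_faces \<sigma> \<subseteq> ccone ` K" using A cone_faces_face subset_closed by auto
  fix \<tau> assume "\<tau> \<in> ccone ` K"
  then obtain B where B: "B \<in> K" "\<tau> = ccone B" by auto
  show "\<sigma> \<inter> \<tau> \<in> cone_faces \<sigma>" "\<sigma> \<inter> \<tau> \<in> cone_faces \<tau>"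
    using A B ccone_Int[OF A(1) B(1)] cone_faces_face by auto
qed

lemma nonsingular_cones: "nonsingular_fan N (ccone ` K)"
  unfolding nonsingular_fan_def using part_of_basis by blast

lemma complete_cones: "complete_fan (ccone ` K)"
  unfolding complete_fan_def using mem_own_ccone coord_supp by blast

lemma nonvanishing_locus_cones:
  "nonvanishing_locus N (ccone ` K) D u = ccone ` {A\<in>K. \<forall>v\<in>A. u \<bullet> v + of_int (D v) = 0}"
  unfolding nonvanishing_locus_def using cone_gens_face by auto

lemma orbit_dim_face:
  assumes "A \<in> K"
  shows "orbit_dim (ccone A) = int DIM('a) - int (card A)"
proof -
  have "span (ccone A) = span A"
  proof (rule span_eq[THEN iffD2], intro conjI)
    show "ccone A \<subseteq> span A" by (rule ccone_subset_span)
    show "A \<subseteq> span (ccone A)" using hull_subset[of A convex_cone] span_superset by blast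
  qed
  then have "dim (ccone A) = card A"
    using dim_span dim_eq_card_independent[OF face_independent[OF assms]] by metis
  moreover have "aff_dim (ccone A) = int (dim (ccone A))"
    by (rule aff_dim_zero) (simp add: hull_inc convex_cone_hull_contains_0)
  ultimately show ?thesis by (simp add: orbit_dim_def)
qed

text \<open>
  A cone \<open>\<sigma>'\<close> and the center \<open>\<tau>\<close> are faces of a common cone iff the union of their generator sets is a face
  of the complex.
\<close>

lemma blow_up_cones:
  assumes "S \<subseteq> K"
  shows "blow_up N (ccone ` K) (ccone ` S) = ccone ` star K S"
proof -
  have SK: "T \<in> K" if "T \<in> S" for T using that assms by blast
  have "{\<sigma> \<in> ccone ` K. \<forall>\<tau>\<in>ccone ` S. \<tau> \<notin> cone_faces \<sigma>} = ccone ` {A\<in>K. \<forall>T\<in>S. \<not> T \<subseteq> A}"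
    using ccone_mem_faces_iff SK by auto
  moreover have "{convex_cone hull (insert (\<Sum>v\<in>cone_gens N \<tau>. v) \<sigma>') | \<tau> \<sigma>'.
        \<tau> \<in> ccone ` S \<and> \<sigma>' \<in> ccone ` K \<and> \<tau> \<notin> cone_faces \<sigma>' \<and>
        (\<exists>\<sigma>\<in>ccone ` K. \<tau> \<in> cone_faces \<sigma> \<and> \<sigma>' \<in> cone_faces \<sigma>)} =
     ccone ` {insert (\<Sum>T) A | T A. T \<in> S \<and> A \<in> K \<and> \<not> T \<subseteq> A \<and> A \<union> T \<in> K}" (is "?L = ?R")
  proof -
    have common: "(\<exists>\<sigma>\<in>ccone ` K. ccone T \<in> cone_faces \<sigma> \<and> ccone A \<in> cone_faces \<sigma>) \<longleftrightarrow> A \<union> T \<in> K"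
      if "T \<in> S" "A \<in> K" for T A
    proof
      assume "\<exists>\<sigma>\<in>ccone ` K. ccone T \<in> cone_faces \<sigma> \<and> ccone A \<in> cone_faces \<sigma>"
      then obtain C where C: "C \<in> K" "ccone T \<in> cone_faces (ccone C)" "ccone A \<in> cone_faces (ccone C)"
        by blast
      then have "T \<subseteq> C" "A \<subseteq> C" using ccone_mem_faces_iff[OF C(1)] that SK by blast+
      then show "A \<union> T \<in> K" using subset_closed[OF C(1), of "A \<union> T"] by simp
    next
      assume "A \<union> T \<in> K"
      then show "\<exists>\<sigma>\<in>ccone ` K. ccone T \<in> cone_faces \<sigma> \<and> ccone A \<in> cone_faces \<sigma>"
        using that SK ccone_mem_faces_iff by (intro bexI[of _ "ccone (A \<union> T)"]) auto
    qed
    have "?L = {convex_cone hull (insert (\<Sum>v\<in>cone_gens N (ccone T). v) (ccone A)) | T A.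
        T \<in> S \<and> A \<in> K \<and> ccone T \<notin> cone_faces (ccone A) \<and>
        (\<exists>\<sigma>\<in>ccone ` K. ccone T \<in> cone_faces \<sigma> \<and> ccone A \<in> cone_faces \<sigma>)}"
      by blast
    also have "\<dots> = {ccone (insert (\<Sum>T) A) | T A. T \<in> S \<and> A \<in> K \<and> \<not> T \<subseteq> A \<and> A \<union> T \<in> K}"
    proof -
      have "convex_cone hull (insert (\<Sum>v\<in>cone_gens N (ccone T). v) (ccone A)) = ccone (insert (\<Sum>T) A)"
        if "T \<in> S" for T A
        using cone_gens_face[OF SK[OF that]] by (simp add: hull_insert[symmetric])
      then show ?thesis using common ccone_mem_faces_iff SK by (metis (lifting))
    qed
    also have "\<dots> = ?R" by blast
    finally show ?thesis .
  qed
  ultimately show ?thesis unfolding blow_up_def star_def image_Un by simp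
qed

end

definition complex_of :: "'a::euclidean_space set \<Rightarrow> 'a set set \<Rightarrow> 'a set set" where
  "complex_of N \<Delta> = {A. (\<exists>B. lattice_basis N B \<and> A \<subseteq> B) \<and> ccone A \<in> \<Delta>}"

lemma complex_of_smooth:
  assumes fan: "fan N \<Delta>" "nonsingular_fan N \<Delta>" "complete_fan \<Delta>"
  shows "smooth_complex N (complex_of N \<Delta>)" "ccone ` complex_of N \<Delta> = \<Delta>"
proof -
  show im: "ccone ` complex_of N \<Delta> = \<Delta>"
  proof (intro equalityI subsetI)
    fix \<sigma> assume \<sigma>: "\<sigma> \<in> \<Delta>"
    then obtain B A where "lattice_basis N B" "A \<subseteq> B" "\<sigma> = ccone A"
      using fan(2) unfolding nonsingular_fan_def by blast
    then show "\<sigma> \<in> ccone ` complex_of N \<Delta>" using \<sigma> by (auto simp: complex_of_def)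
  qed (auto simp: complex_of_def)
  have ind: "independent A" if "A \<in> complex_of N \<Delta>" for A
    using that lattice_basis_independent unfolding complex_of_def by blast
  have fin: "finite A" if "A \<in> complex_of N \<Delta>" for A using ind[OF that] independent_imp_finite by blast
  have gens: "cone_gens N (ccone A) = A" if "A \<in> complex_of N \<Delta>" for A
    using that cone_gens_ccone unfolding complex_of_def by blast
  have closed: "A' \<in> complex_of N \<Delta>" if A: "A \<in> complex_of N \<Delta>" "A' \<subseteq> A" for A A'
  proof -
    have "ccone A' \<in> cone_faces (ccone A)" using cone_faces_ccone[OF ind[OF A(1)]] A(2) by auto
    then have "ccone A' \<in> \<Delta>" using fan(1) A(1) unfolding fan_def complex_of_def by blast
    then show ?thesis using A unfolding complex_of_def by blast
  qed
  \<comment> \<open>A point interior to the cones of \<open>A\<close> and \<open>B\<close> lies in no proper face of them.\<close>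
  have sub: "ccone (supp c) \<subseteq> ccone (supp d)"
    if c: "repr (complex_of N \<Delta>) c x" and d: "repr (complex_of N \<Delta>) d x" for c d x
  proof -
    let ?A = "supp c" and ?B = "supp d"
    have AB: "?A \<in> complex_of N \<Delta>" "?B \<in> complex_of N \<Delta>" using c d by (auto simp: repr_def)
    have xA: "x \<in> ccone ?A" "x \<in> ccone ?B"
      using lin_in_ccone[OF fin[OF AB(1)], of c] lin_in_ccone[OF fin[OF AB(2)], of d] c d
      by (auto simp: repr_def)
    have "ccone ?A \<inter> ccone ?B \<in> cone_faces (ccone ?A)"
      using fan(1) AB unfolding fan_def complex_of_def by blast
    then obtain C where C: "C \<subseteq> ?A" "ccone ?A \<inter> ccone ?B = ccone C"
      using cone_faces_ccone[OF ind[OF AB(1)]] by auto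
    have "lin c \<in> ccone C" using xA C c by (auto simp: repr_def)
    then have "?A \<subseteq> C" using ccone_independent_mem[OF ind[OF AB(1)] subset_refl C(1)] by blast
    then show ?thesis using C by auto
  qed
  have uniq: "c = d" if c: "repr (complex_of N \<Delta>) c x" and d: "repr (complex_of N \<Delta>) d x" for c d x
  proof -
    have AB: "supp c \<in> complex_of N \<Delta>" "supp d \<in> complex_of N \<Delta>" using c d by (auto simp: repr_def)
    have "ccone (supp c) = ccone (supp d)" using sub[OF c d] sub[OF d c] by blast
    then have "supp c = supp d" using gens AB by metis
    then show ?thesis using lin_inj[OF ind[OF AB(1)], of c d] c d by (simp add: repr_def)
  qed
  show "smooth_complex N (complex_of N \<Delta>)"
  proof
    show "finite (complex_of N \<Delta>)"
    proof (rule finite_imageD)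
      show "finite (ccone ` complex_of N \<Delta>)" using im fan(1) by (simp add: fan_def)
      show "inj_on ccone (complex_of N \<Delta>)" using gens by (metis inj_onI)
    qed
    show "A' \<in> complex_of N \<Delta>" if "A \<in> complex_of N \<Delta>" "A' \<subseteq> A" for A A' using closed that .
    show "\<exists>B. lattice_basis N B \<and> A \<subseteq> B" if "A \<in> complex_of N \<Delta>" for A
      using that by (simp add: complex_of_def)
    fix x
    have "x \<in> \<Union>(ccone ` complex_of N \<Delta>)" using fan(3) im by (simp add: complete_fan_def)
    then obtain A where A: "A \<in> complex_of N \<Delta>" "x \<in> ccone A" by blast
    then obtain c where c: "\<forall>a. 0 \<le> c a" "supp c \<subseteq> A" "lin c = x" using ccone_finite[OF fin] by blast
    then have "repr (complex_of N \<Delta>) c x" using closed[OF A(1)] by (simp add: repr_def)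
    then show "\<exists>!c. repr (complex_of N \<Delta>) c x" using uniq by blast
  qed
qed

text \<open>
  The nonvanishing locus of a section is read off from the generators at which its form takes the value \<open>1\<close>.
\<close>

lemma complex_of_fano:
  assumes "nonsingular_toric_fano N \<Delta>"
  shows "fano_complex N (complex_of N \<Delta>)"
proof -
  have fan: "fan N \<Delta>" "nonsingular_fan N \<Delta>" "complete_fan \<Delta>" and ample: "ample_divisor N \<Delta> anticanonical_divisor"
    using assms by (auto simp: nonsingular_toric_fano_def)
  define K where "K = complex_of N \<Delta>"
  interpret smooth_complex N K unfolding K_def by (rule complex_of_smooth(1)[OF fan])
  have im: "\<Delta> = ccone ` K" unfolding K_def using complex_of_smooth(2)[OF fan] by simp
  have "fano_complex N K"
  proof
    fix A assume A: "A \<in> K"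
    then have "ccone A \<in> \<Delta>" by (simp add: im)
    then obtain k u \<tau> where k: "k \<ge> 1" and \<tau>: "\<tau> \<in> \<Delta>"
      and u: "u \<in> character_sections N \<Delta> (\<lambda>v. k * anticanonical_divisor v)"
      and nv: "ccone A \<in> nonvanishing_locus N \<Delta> (\<lambda>v. k * anticanonical_divisor v) u"
      "nonvanishing_locus N \<Delta> (\<lambda>v. k * anticanonical_divisor v) u = cone_faces \<tau>"
      using ample unfolding ample_divisor_def by blast
    obtain T where T: "T \<in> K" "\<tau> = ccone T" using \<tau> im by auto
    define w where "w = (- 1 / of_int k) *\<^sub>R u"
    have le: "w \<bullet> v \<le> 1" if "v \<in> V" for v
    proof -
      have "0 \<le> u \<bullet> v + of_int k"
        using u that unfolding character_sections_def im fan_gens_cones anticanonical_divisor_def by auto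
      then show ?thesis using k by (simp add: w_def divide_simps)
    qed
    have eq: "w \<bullet> v = 1 \<longleftrightarrow> u \<bullet> v + of_int k = 0" for v
      using k by (auto simp: w_def divide_simps)
    have locus: "ccone B \<in> cone_faces (ccone T) \<longleftrightarrow> (\<forall>v\<in>B. w \<bullet> v = 1)" if B: "B \<in> K" for B
    proof -
      have "ccone B \<in> cone_faces (ccone T) \<longleftrightarrow>
          ccone B \<in> ccone ` {A\<in>K. \<forall>v\<in>A. u \<bullet> v + of_int (k * anticanonical_divisor v) = 0}"
        using nv(2) T(2) by (simp add: im nonvanishing_locus_cones)
      also have "\<dots> \<longleftrightarrow> (\<forall>v\<in>B. u \<bullet> v + of_int k = 0)"
        using B ccone_eq_iff by (auto simp: anticanonical_divisor_def)
      finally show ?thesis by (simp add: eq)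
    qed
    have "A \<subseteq> T" using nv T ccone_mem_faces_iff[OF T(1) A] by simp
    moreover have "w \<bullet> v = 1 \<longleftrightarrow> v \<in> T" if "v \<in> V" for v
      using locus[OF vertex_face[OF that]] ccone_mem_faces_iff[OF T(1) vertex_face[OF that]] by simp
    ultimately show "\<exists>w T. T \<in> K \<and> A \<subseteq> T \<and> (\<forall>v\<in>V. w \<bullet> v \<le> 1 \<and> (w \<bullet> v = 1 \<longleftrightarrow> v \<in> T))"
      using T le by blast
  qed
  then show ?thesis by (simp add: K_def)
qed

text \<open>
  The form that supports a triangle takes integral values on a lattice basis, so minus this form is a
  character and a section of the anticanonical bundle itself.
\<close>

lemma fano_cones:
  assumes "fano_complex N K" and dim: "DIM('a::euclidean_space) = 3"
  shows "nonsingular_toric_fano N (ccone ` (K :: 'a set set))"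
proof -
  interpret fano_complex N K by (rule assms(1))
  interpret threefold_complex N K by unfold_locales (rule dim)
  have "ample_divisor N (ccone ` K) anticanonical_divisor"
    unfolding ample_divisor_def
  proof
    fix \<sigma> assume "\<sigma> \<in> ccone ` K"
    then obtain A where A: "A \<in> K" "\<sigma> = ccone A" by auto
    obtain T where T: "T \<in> K" "card T = 3" "A \<subseteq> T" using face_in_triangle[OF A(1)] by blast
    obtain w T' where T': "T' \<in> K" "T \<subseteq> T'" and w: "\<forall>v\<in>V. w \<bullet> v \<le> 1 \<and> (w \<bullet> v = 1 \<longleftrightarrow> v \<in> T')"
      using supporting[OF T(1)] by blast
    have "T = T'" using T T' face_card_le[OF T'(1)] face_finite[OF T'(1)] by (intro card_seteq) auto
    obtain u where u: "u \<in> dual_lattice N" "\<forall>b\<in>T. u \<bullet> b = of_int (- 1)"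
      using lattice_basis_dual[OF triangle_basis[OF T(1,2)], of "\<lambda>_. - 1"] by blast
    have uw: "u \<bullet> v = - (w \<bullet> v)" for v
    proof -
      obtain c where c: "supp c \<subseteq> T" "lin c = v"
        using lattice_basis_lin[OF triangle_basis[OF T(1,2)]] by blast
      have wT: "w \<bullet> b = 1" if "b \<in> T" for b using w that \<open>T = T'\<close> T(1) by blast
      show ?thesis
        using c(2) u(2) wT face_finite[OF T(1)]
        by (auto simp: lin_eq_sum[OF _ c(1)] inner_sum_right sum_negf[symmetric] intro!: sum.cong)
    qed
    have eq: "u \<bullet> v + 1 = 0 \<longleftrightarrow> v \<in> T" if "v \<in> V" for v
      using w that uw[of v] \<open>T = T'\<close> by auto
    have locus: "nonvanishing_locus N (ccone ` K) (\<lambda>v. 1 * anticanonical_divisor v) u = cone_faces (ccone T)"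
    proof -
      have "{A\<in>K. \<forall>v\<in>A. u \<bullet> v + of_int (1 * anticanonical_divisor v) = 0} = Pow T"
        using eq subset_closed[OF T(1)] by (auto simp: anticanonical_divisor_def)
      then show ?thesis using cone_faces_face[OF T(1)] by (simp add: nonvanishing_locus_cones)
    qed
    show "\<exists>k\<ge>1. \<exists>u\<in>character_sections N (ccone ` K) (\<lambda>v. k * anticanonical_divisor v). \<exists>\<tau>\<in>ccone ` K.
        \<sigma> \<in> nonvanishing_locus N (ccone ` K) (\<lambda>v. k * anticanonical_divisor v) u \<and>
        nonvanishing_locus N (ccone ` K) (\<lambda>v. k * anticanonical_divisor v) u = cone_faces \<tau>"
    proof (intro exI conjI bexI)
      show "u \<in> character_sections N (ccone ` K) (\<lambda>v. 1 * anticanonical_divisor v)"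
        using u(1) w uw by (auto simp: character_sections_def fan_gens_cones anticanonical_divisor_def)
      show "\<sigma> \<in> nonvanishing_locus N (ccone ` K) (\<lambda>v. 1 * anticanonical_divisor v) u"
        unfolding locus using A T ccone_mem_faces_iff by simp
    qed (use locus T in auto)
  qed
  then show ?thesis
    using fan_cones nonsingular_cones complete_cones by (simp add: nonsingular_toric_fano_def)
qed

text \<open>
  The cone of \<open>L\<close> around a generator \<open>v\<close> of \<open>K\<close> lies in a cone of \<open>K\<close>, of which the ray of \<open>v\<close> is a face.
  So all its generators lie on this ray, and by primitivity \<open>v\<close> is one of them.
\<close>

lemma morphism_vertices:
  assumes "smooth_complex N K" "smooth_complex N L" "equivariant_morphism (ccone ` L) (ccone ` K)"
  shows "\<Union>K \<subseteq> \<Union>L"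
proof
  interpret K: smooth_complex N K by (rule assms(1))
  interpret L: smooth_complex N L by (rule assms(2))
  fix v assume v: "v \<in> \<Union>K"
  let ?B = "supp (L.coord v)"
  have BL: "?B \<in> L" by (rule L.coord_supp)
  then obtain A where A: "A \<in> K" "ccone ?B \<subseteq> ccone A"
    using assms(3) unfolding equivariant_morphism_def by blast
  have vA: "v \<in> ccone A" using A L.mem_own_ccone by blast
  have "?B \<noteq> {}"
    using L.lin_coord[of v] K.vertex_lattice(2)[OF v] by (auto simp: lin_def)
  then obtain b where b: "b \<in> ?B" by blast
  have bL: "b \<in> \<Union>L" using b BL by blast
  let ?d = "(\<lambda>a. L.coord v a - (if a = b then L.coord v b else 0))"
  define r where "r = lin ?d"
  have fin: "finite ?B" using BL by (rule L.face_finite)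
  have sb: "supp (\<lambda>a. if a = b then L.coord v b else 0) \<subseteq> ?B" using b by (auto simp: supp_subset)
  have r: "r = v - L.coord v b *\<^sub>R b" "supp ?d \<subseteq> ?B"
    using lin_diff[OF fin subset_refl sb] lin_single(1) by (auto simp: r_def L.lin_coord)
  have "\<forall>a. 0 \<le> ?d a" using L.coord_nonneg[of v] by simp
  then have rA: "r \<in> ccone A" using lin_in_ccone[OF fin _ r(2)] A(2) unfolding r_def by blast
  have bA: "b \<in> ccone A" using A(2) b hull_subset[of ?B convex_cone] by blast
  have pos: "0 < L.coord v b" using b L.coord_nonneg[of v b] by (auto simp: supp_def)
  have "K.coord v = (\<lambda>a. K.coord (L.coord v b *\<^sub>R b) a + K.coord r a)"
  proof -
    have "L.coord v b *\<^sub>R b \<in> ccone A" using bA pos by (simp add: convex_cone_hull_mul)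
    from K.coord_add(1)[OF A(1) this rA] show ?thesis by (simp add: r(1))
  qed
  then have c: "K.coord v a = L.coord v b * K.coord b a + K.coord r a" for a
    using K.coord_scale(1)[of "L.coord v b" b] pos by (simp add: fun_eq_iff)
  have "K.coord b a = 0" if "a \<noteq> v" for a
  proof -
    have "K.coord v a = 0" using that by (simp add: K.coord_vertex(1)[OF v])
    then have "L.coord v b * K.coord b a + K.coord r a = 0" using c[of a] by simp
    moreover have "0 \<le> L.coord v b * K.coord b a" using pos K.coord_nonneg[of b a] by simp
    ultimately have "L.coord v b * K.coord b a = 0" using K.coord_nonneg[of r a] by linarith
    then show ?thesis using pos by simp
  qed
  then have "supp (K.coord b) \<subseteq> {v}" by (auto simp: supp_def)
  then have "b = K.coord b v *\<^sub>R v" using K.lin_coord[of b] by (simp add: lin_eq_sum[of "{v}"])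
  then have "b = v"
    using primitive_on_ray[of N b v] L.vertex_lattice(3)[OF bL] K.vertex_lattice(3)[OF v] K.coord_nonneg[of b v]
    by blast
  then show "v \<in> \<Union>L" using bL by simp
qed


section \<open>Structure of the subdivided complexes\<close>

context star_subdivision
begin

lemma center_in_face:
  assumes F: "F \<in> star K S" and T: "T \<in> S" "\<Sum>T \<in> F"
  shows "F - {\<Sum>T} \<in> K" "\<not> T \<subseteq> F - {\<Sum>T}" "F - {\<Sum>T} \<union> T \<in> K"
proof -
  have "\<exists>C. F = insert (\<Sum>T) C \<and> C \<in> K \<and> \<not> T \<subseteq> C \<and> C \<union> T \<in> K"
    using F
  proof (cases rule: starE)
    case old
    then show ?thesis using center_not_vertex[OF T(1)] T(2) by blast
  next
    case (new T' C)
    have "\<Sum>T \<notin> C" using center_not_vertex[OF T(1)] new(3) by blast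
    then have "\<Sum>T = \<Sum>T'" using new(1) T(2) by blast
    then have "T = T'" using coord_face_sum(2) centers T(1) new(2) by (metis subsetD)
    then show ?thesis using new by blast
  qed
  then obtain C where C: "F = insert (\<Sum>T) C" "C \<in> K" "\<not> T \<subseteq> C" "C \<union> T \<in> K" by blast
  moreover have "\<Sum>T \<notin> C" using center_not_vertex[OF T(1)] C(2) by blast
  ultimately have "F - {\<Sum>T} = C" by blast
  then show "F - {\<Sum>T} \<in> K" "\<not> T \<subseteq> F - {\<Sum>T}" "F - {\<Sum>T} \<union> T \<in> K" using C by auto
qed

lemma no_center_in_face:
  assumes "F \<in> star K S" "\<And>T. T \<in> S \<Longrightarrow> \<Sum>T \<notin> F"
  shows "F \<in> K"
  using assms(1) by (cases rule: starE) (use assms(2) in auto)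

end


section \<open>Blowing up curves\<close>

text \<open>
  A triangle that violates this condition can only be subdivided by blowing up its point, since none
  of the three curves through this point belongs to a generator of \<open>L\<close>.
\<close>

definition points_resolved :: "'a::euclidean_space set set \<Rightarrow> 'a set set \<Rightarrow> bool" where
  "points_resolved K L \<longleftrightarrow>
     (\<forall>T\<in>K. card T = 3 \<longrightarrow> \<Sum>T \<in> \<Union>L \<longrightarrow> (\<exists>p\<in>T. \<exists>q\<in>T. p \<noteq> q \<and> p + q \<in> \<Union>L))"

lemma triangle_center:
  assumes "star_subdivision N K {{a, b}}" "threefold_complex N K" "a \<noteq> b"
    and T: "{a + b, q, r} \<in> star K {{a, b}}" "card {a + b, q, r} = 3"
  shows "{a, b, q} \<in> K \<and> card {a, b, q} = 3 \<and> r \<in> {a, b} \<or>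
    {a, b, r} \<in> K \<and> card {a, b, r} = 3 \<and> q \<in> {a, b}"
proof -
  interpret star_subdivision N K "{{a, b}}" by (rule assms(1))
  interpret threefold_complex N K by (rule assms(2))
  have s: "\<Sum>{a, b} = a + b" using assms(3) by simp
  have d: "a + b \<noteq> q" "a + b \<noteq> r" "q \<noteq> r" using T(2) by (auto simp: card_insert_if split: if_splits)
  have e: "{a + b, q, r} - {\<Sum>{a, b}} = {q, r}" using d by (auto simp: s)
  have f: "\<not> {a, b} \<subseteq> {q, r}" "{q, r} \<union> {a, b} \<in> K"
    using center_in_face[OF T(1), of "{a, b}"] unfolding e by (auto simp: s)
  have "card ({q, r} \<union> {a, b}) \<le> 3" by (rule face_card_le[OF f(2)])
  then have "q \<in> {a, b} \<or> r \<in> {a, b}" using assms(3) d by (auto simp: card_insert_if split: if_splits)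
  then show ?thesis
  proof
    assume q: "q \<in> {a, b}"
    then have "r \<notin> {a, b}" using f(1) d by auto
    moreover have "{q, r} \<union> {a, b} = {a, b, r}" using q by auto
    ultimately show ?thesis using f(2) q assms(3) by (auto simp: card_insert_if)
  next
    assume r: "r \<in> {a, b}"
    then have "q \<notin> {a, b}" using f(1) d by auto
    moreover have "{q, r} \<union> {a, b} = {a, b, q}" using r by auto
    ultimately show ?thesis using f(2) r assms(3) by (auto simp: card_insert_if)
  qed
qed

text \<open>
  Let \<open>{a, b} = {x, y}\<close> and let \<open>e = a + b\<close> be the new generator. The walls through \<open>e\<close> are convex:
  their relations are \<open>a + b = e\<close>, or they come from the relation of the wall \<open>{a, b}\<close> of \<open>K\<close>. A wall opposite
  to \<open>e\<close> is of the form \<open>{x, c}\<close>; if it were not convex, two adjacent edges would be subdivided.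
  Next, a new triangle \<open>{e, x, c}\<close> that violates \<open>points_resolved\<close> would have \<open>{e, c}\<close> as a face
  of \<open>L\<close>, and then \<open>(e + x + c) + y = 2 e + c\<close> has degree \<open>3\<close>, although the left side is a sum of two
  generators.
\<close>

theorem curve_blow_up:
  assumes "coarser_complex N K L" "fano_complex N K" "points_resolved K L"
    and ab: "{a, b} \<in> K" "a \<noteq> b" "a + b \<in> \<Union>L"
  shows "coarser_complex N (star K {{a, b}}) L" "fano_complex N (star K {{a, b}})"
    "points_resolved (star K {{a, b}}) L" "\<Union>(star K {{a, b}}) = insert (a + b) (\<Union>K)" "a + b \<notin> \<Union>K"
proof -
  interpret coarser_complex N K L by (rule assms(1))
  interpret fano: fano_complex N K by (rule assms(2))
  define K' where "K' = star K {{a, b}}"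
  define e where "e = a + b"
  interpret st: star_subdivision N K "{{a, b}}"
    by unfold_locales (use ab in auto)
  show e_new: "a + b \<notin> \<Union>K" using st.center_not_vertex[of "{a, b}"] ab(2) by simp
  show vert: "\<Union>(star K {{a, b}}) = insert (a + b) (\<Union>K)" using st.star_vertices ab(2) by simp
  interpret K': smooth_complex N K' unfolding K'_def by (rule st.smooth_complex_star)
  interpret K': coarser_complex N K' L
    by unfold_locales (use dim_3 vert vertices ab(3) in \<open>auto simp: K'_def\<close>)
  show "coarser_complex N (star K {{a, b}}) L" using K'.coarser_complex_axioms by (simp add: K'_def)
  have old: "F \<in> K" if "F \<in> K'" "e \<notin> F" for F
    using st.no_center_in_face[of F] that ab(2) by (simp add: K'_def e_def)
  have new: "{a, b, q} \<in> K \<and> card {a, b, q} = 3 \<and> r \<in> {a, b} \<or>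
    {a, b, r} \<in> K \<and> card {a, b, r} = 3 \<and> q \<in> {a, b}" if "{e, q, r} \<in> K'" "card {e, q, r} = 3" for q r
    using triangle_center[OF st.star_subdivision_axioms threefold_complex_axioms ab(2)] that
    by (simp add: K'_def e_def)
  \<comment> \<open>A wall \<open>{x, c}\<close> next to the subdivided edge \<open>{a, b} = {x, y}\<close>.\<close>
  have side: False if T: "{e, p, q} \<in> K'" "card {e, p, q} = 3" and s: "s \<in> \<Union>L" "e + s = p + q"
    and pq: "p + q \<in> \<Union>L" for p q s
  proof -
    have "\<exists>x y c. {a, b} = {x, y} \<and> x + y = e \<and> {p, q} = {x, c} \<and> x + c = p + q \<and>
      {a, b, c} \<in> K \<and> card {a, b, c} = 3"
      using new[OF T]
    proof
      assume h: "{a, b, p} \<in> K \<and> card {a, b, p} = 3 \<and> q \<in> {a, b}"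
      show ?thesis
      proof (cases "q = a")
        case True
        show ?thesis by (intro exI[of _ a] exI[of _ b] exI[of _ p]) (use h True in \<open>auto simp: e_def\<close>)
      next
        case False
        show ?thesis by (intro exI[of _ b] exI[of _ a] exI[of _ p]) (use h False in \<open>auto simp: e_def\<close>)
      qed
    next
      assume h: "{a, b, q} \<in> K \<and> card {a, b, q} = 3 \<and> p \<in> {a, b}"
      show ?thesis
      proof (cases "p = a")
        case True
        show ?thesis by (intro exI[of _ a] exI[of _ b] exI[of _ q]) (use h True in \<open>auto simp: e_def\<close>)
      next
        case False
        show ?thesis by (intro exI[of _ b] exI[of _ a] exI[of _ q]) (use h False in \<open>auto simp: e_def\<close>)
      qed
    qed
    then obtain x y c where x: "{a, b} = {x, y}" "x + y = e" "x + c = p + q"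
      and "{a, b, c} \<in> K" "card {a, b, c} = 3" by blast
    moreover have "{a, b, c} = {x, y, c}" using x(1) by auto
    ultimately have c: "{x, y, c} \<in> K" "card {x, y, c} = 3" by auto
    have V: "x \<in> \<Union>L" "y \<in> \<Union>L" "c \<in> \<Union>L" using face_vertices[OF c(1)] by auto
    have "s = c - y" using s(2) x(2,3) by (metis add_diff_cancel_left add_diff_cancel_left' add.assoc diff_diff_eq2 diff_add_cancel add.commute)
    then have cy: "c - y \<in> \<Union>L" using s by simp
    show False
    proof (rule fine.no_adjacent_subdivided_edges[OF V])
      show "x + y \<in> \<Union>L" "x + c \<in> \<Union>L" using x ab(3) pq by (simp_all add: e_def)
      show "c - y \<in> \<Union>L" by (rule cy)
      show "y \<noteq> c" using c(2) by (auto simp: card_insert_if split: if_splits)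
      show "c \<noteq> x + y" using triangle_independent(1)[OF c, of 1 1 "-1"] by auto
      show "y + c \<noteq> 0" using triangle_independent(2)[OF c, of 0 1 1] by auto
      show "x + y + c \<noteq> 0" using triangle_independent(1)[OF c, of 1 1 1] by auto
      show "2 *\<^sub>R x + y + c \<noteq> 0" using triangle_independent(1)[OF c, of 2 1 1] by auto
    qed
  qed
  have middle: False if r: "{e, q, r} \<in> K'" "card {e, q, r} = 3" and s: "{e, q, s} \<in> K'" "card {e, q, s} = 3"
    and rs: "r \<noteq> s" "r + s = e + q" for q r s
  proof (cases "q \<in> {a, b}")
    case True
    then have r': "{a, b, r} \<in> K" "card {a, b, r} = 3" and s': "{a, b, s} \<in> K" "card {a, b, s} = 3"
      using new[OF r] new[OF s] by (auto simp: card_insert_if split: if_splits)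
    have "r + s = 2 *\<^sub>R a + 1 *\<^sub>R b \<or> r + s = 1 *\<^sub>R a + 2 *\<^sub>R b"
      using True rs(2) by (auto simp: e_def scaleR_2)
    then show False using fano.convex_wall[OF dim_3 r' s' rs(1)] by fastforce
  next
    case False
    then have h: "r \<in> {a, b}" "s \<in> {a, b}" "{a, b, q} \<in> K" using new[OF r] new[OF s] by auto
    then have "r + s = e" using rs(1) by (auto simp: e_def add.commute)
    moreover have "q \<in> \<Union>K" using UnionI[OF h(3)] by simp
    ultimately show False using rs(2) vertex_lattice(2)[of q] by simp
  qed
  have "fano_complex N K'"
  proof (rule K'.fano_if_no_flopping_wall)
    fix p q r s
    assume r: "{p, q, r} \<in> K'" "card {p, q, r} = 3" and s: "{p, q, s} \<in> K'" "card {p, q, s} = 3"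
      and rs: "r \<noteq> s" "r + s = p + q" and pq: "p + q \<in> \<Union>L"
    have V: "r \<in> \<Union>L" "s \<in> \<Union>L" using K'.face_vertices[OF r(1)] K'.face_vertices[OF s(1)] by auto
    consider "e = r" | "e = s" | "e = p" | "e = q" | "e \<notin> {p, q, r, s}" by blast
    then show False
    proof cases
      case 1
      then show False using side[of p q s] r V rs pq by (simp add: insert_commute)
    next
      case 2
      then show False using side[of p q r] s V rs pq by (simp add: insert_commute add.commute)
    next
      case 3
      then show False using middle[of q r s] r s rs by simp
    next
      case 4
      then show False using middle[of p r s] r s rs by (simp add: insert_commute add.commute)
    next
      case 5
      then have "{p, q, r} \<in> K" "{p, q, s} \<in> K" using old r s by auto
      then show False using fano.convex_wall[OF dim_3 _ r(2) _ s(2) rs(1), of 1 1] rs(2) by simp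
    qed
  qed
  then show "fano_complex N (star K {{a, b}})" by (simp add: K'_def)
  have "points_resolved K' L"
    unfolding points_resolved_def
  proof (intro ballI impI)
    fix T assume T: "T \<in> K'" "card T = 3" "\<Sum>T \<in> \<Union>L"
    show "\<exists>p\<in>T. \<exists>q\<in>T. p \<noteq> q \<and> p + q \<in> \<Union>L"
    proof (cases "e \<in> T")
      case False
      then show ?thesis using old[OF T(1)] T assms(3) by (auto simp: points_resolved_def)
    next
      case True
      show ?thesis
      proof (rule ccontr)
        assume no: "\<not> ?thesis"
        have "card (T - {e}) = 2" using T True K'.face_finite[OF T(1)] by simp
        then obtain q r where "T - {e} = {q, r}" "q \<noteq> r" by (meson card_2_iff)
        then have Te: "T = {e, q, r}" and d: "q \<noteq> r" "e \<noteq> q" "e \<noteq> r" using True by auto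
        have "\<exists>x y c. T = {e, x, c} \<and> x + y = e \<and> {a, b} = {x, y} \<and> {a, b, c} \<in> K \<and> card {a, b, c} = 3"
        proof -
          have "{a, b, q} \<in> K \<and> card {a, b, q} = 3 \<and> r \<in> {a, b} \<or>
            {a, b, r} \<in> K \<and> card {a, b, r} = 3 \<and> q \<in> {a, b}" using new[of q r] T Te by simp
          then show ?thesis
          proof
            assume "{a, b, q} \<in> K \<and> card {a, b, q} = 3 \<and> r \<in> {a, b}"
            then show ?thesis using Te
              by (intro exI[of _ r] exI[of _ "if r = a then b else a"] exI[of _ q]) (auto simp: e_def add.commute)
          next
            assume "{a, b, r} \<in> K \<and> card {a, b, r} = 3 \<and> q \<in> {a, b}"
            then show ?thesis using Te
              by (intro exI[of _ q] exI[of _ "if q = a then b else a"] exI[of _ r]) (auto simp: e_def add.commute)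
          qed
        qed
        then obtain x y c where x: "T = {e, x, c}" "x + y = e" "{a, b} = {x, y}"
          and "{a, b, c} \<in> K" "card {a, b, c} = 3" by blast
        moreover have "{a, b, c} = {x, y, c}" using x(3) by auto
        ultimately have c: "{x, y, c} \<in> K" "card {x, y, c} = 3" by auto
        have V: "x \<in> \<Union>L" "y \<in> \<Union>L" "c \<in> \<Union>L" "e \<in> \<Union>L" using face_vertices[OF c(1)] ab(3) by (auto simp: e_def)
        have dist: "e \<noteq> x" "e \<noteq> c" "x \<noteq> c" using T(2) x(1) by (auto simp: card_insert_if split: if_splits)
        have "e + c \<notin> \<Union>L" using no dist x(1) by auto
        moreover have "e + c \<noteq> 0" using triangle_independent(1)[OF c, of 1 1 1] x(2) by auto
        ultimately have ec: "{e, c} \<in> L" using fine.nonface_sum_vertex V by blast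
        have sT: "\<Sum>T = e + x + c" using dist by (simp add: x(1) add.assoc)
        have "\<Sum>T + y = 2 *\<^sub>R e + 1 *\<^sub>R c" unfolding sT using x(2) by (auto simp: scaleR_2 algebra_simps)
        then have "fine.deg (\<Sum>T + y) = 3" using fine.deg_pair(1)[OF ec, of 2 1] by simp
        moreover have "fine.deg (\<Sum>T + y) \<le> 2"
          using fine.deg_subadditive[of "\<Sum>T" y] fine.coord_vertex(3)[OF T(3)] fine.coord_vertex(3)[OF V(2)] by simp
        ultimately show False by simp
      qed
    qed
  qed
  then show "points_resolved (star K {{a, b}}) L" by (simp add: K'_def)
qed


section \<open>Blowing up points\<close>

text \<open>
  Only walls that contain the center of a blown-up triangle \<open>T\<close> or are edges of \<open>T\<close> are affected. The
  former are convex by a direct computation, and the latter are not subdivided in \<open>L\<close>. For a new triangle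
  \<open>{\<Sum>T, q, r}\<close> with \<open>T = {q, r, t}\<close>, the sum of its vertices is not a generator of \<open>L\<close>, because \<open>\<Sum>T\<close>
  is the midpoint of this sum and \<open>t\<close>.
\<close>

theorem point_blow_ups:
  assumes "coarser_complex N K L" "fano_complex N K"
    and S_def: "S = {T\<in>K. card T = 3 \<and> \<Sum>T \<in> \<Union>L \<and> (\<forall>p\<in>T. \<forall>q\<in>T. p \<noteq> q \<longrightarrow> p + q \<notin> \<Union>L)}"
  shows "coarser_complex N (star K S) L" "fano_complex N (star K S)" "points_resolved (star K S) L"
proof -
  interpret coarser_complex N K L by (rule assms(1))
  interpret fano: fano_complex N K by (rule assms(2))
  have S: "T \<in> K" "card T = 3" "\<Sum>T \<in> \<Union>L" if "T \<in> S" for T using that by (auto simp: S_def)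
  have S_edge: "p + q \<notin> \<Union>L" if "T \<in> S" "p \<in> T" "q \<in> T" "p \<noteq> q" for T p q
    using that by (auto simp: S_def)
  have max: "C = T" if "C \<in> K" "T \<in> S" "T \<subseteq> C" for C T
    using face_card_le[OF that(1)] S(2)[OF that(2)] card_seteq[OF face_finite[OF that(1)] that(3)] by simp
  interpret st: star_subdivision N K S
  proof unfold_locales
    show "S \<subseteq> K" using S(1) by blast
    show "2 \<le> card T" if "T \<in> S" for T using S(2)[OF that] by simp
    show "T = T'" if "C \<in> K" "T \<in> S" "T' \<in> S" "T \<subseteq> C" "T' \<subseteq> C" for C T T'
      using max[OF that(1,2,4)] max[OF that(1,3,5)] by simp
  qed
  define K' where "K' = star K S"
  interpret K': smooth_complex N K' unfolding K'_def by (rule st.smooth_complex_star)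
  interpret K': coarser_complex N K' L
    by unfold_locales (use dim_3 st.star_vertices vertices S(3) in \<open>auto simp: K'_def\<close>)
  show "coarser_complex N (star K S) L" using K'.coarser_complex_axioms by (simp add: K'_def)
  have old: "F \<in> K" if "F \<in> K'" "\<And>T. T \<in> S \<Longrightarrow> \<Sum>T \<notin> F" for F
    using st.no_center_in_face[of F] that by (simp add: K'_def)
  have new: "q \<in> T" "r \<in> T" if "{\<Sum>T, q, r} \<in> K'" "card {\<Sum>T, q, r} = 3" "T \<in> S" for T q r
  proof -
    have d: "\<Sum>T \<noteq> q" "\<Sum>T \<noteq> r" using that(2) by (auto simp: card_insert_if split: if_splits)
    have "{\<Sum>T, q, r} - {\<Sum>T} \<union> T \<in> K"
      using st.center_in_face(3)[of "{\<Sum>T, q, r}" T] that by (simp add: K'_def)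
    then have "{\<Sum>T, q, r} - {\<Sum>T} \<union> T = T" using max that(3) by blast
    then show "q \<in> T" "r \<in> T" using d by auto
  qed
  have side: False if T: "T \<in> S" "{\<Sum>T, p, q} \<in> K'" "card {\<Sum>T, p, q} = 3" "p + q \<in> \<Union>L" for T p q
  proof -
    have "p \<noteq> q" using T(3) by (auto simp: card_insert_if split: if_splits)
    then show False using S_edge[OF T(1) new[OF T(2,3,1)]] T(4) by blast
  qed
  have middle: False if T: "T \<in> S" and r: "{\<Sum>T, q, r} \<in> K'" "card {\<Sum>T, q, r} = 3"
    and s: "{\<Sum>T, q, s} \<in> K'" "card {\<Sum>T, q, s} = 3" and rs: "r \<noteq> s" "r + s = \<Sum>T + q" for T q r s
  proof -
    have "{q, r, s} \<subseteq> T" using new[OF r T] new[OF s T] by blast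
    moreover have d: "q \<noteq> r" "q \<noteq> s" using r(2) s(2) by (auto simp: card_insert_if split: if_splits)
    moreover have "card {q, r, s} = 3" using d rs(1) by simp
    ultimately have Tq: "T = {q, r, s}"
      using S(2)[OF T] card_seteq[OF face_finite[OF S(1)[OF T]], of "{q, r, s}"] by simp
    have "\<Sum>T = q + r + s" using d rs(1) by (simp add: Tq add.assoc)
    then have "2 *\<^sub>R q = 0" using rs(2) by (simp add: scaleR_2 algebra_simps)
    moreover have "q \<noteq> 0" using vertex_lattice(2)[OF UnionI[OF S(1)[OF T]]] Tq by blast
    ultimately show False by simp
  qed
  have "fano_complex N K'"
  proof (rule K'.fano_if_no_flopping_wall)
    fix p q r s
    assume r: "{p, q, r} \<in> K'" "card {p, q, r} = 3" and s: "{p, q, s} \<in> K'" "card {p, q, s} = 3"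
      and rs: "r \<noteq> s" "r + s = p + q" and pq: "p + q \<in> \<Union>L"
    show False
    proof (cases "\<exists>T\<in>S. \<Sum>T \<in> {p, q, r, s}")
      case True
      then obtain T where T: "T \<in> S" "\<Sum>T \<in> {p, q, r, s}" by blast
      consider "\<Sum>T = r" | "\<Sum>T = s" | "\<Sum>T = p" | "\<Sum>T = q" using T(2) by blast
      then show False
      proof cases
        case 1
        then show False using side[OF T(1), of p q] r pq by (simp add: insert_commute)
      next
        case 2
        then show False using side[OF T(1), of p q] s pq by (simp add: insert_commute)
      next
        case 3
        then show False using middle[OF T(1), of q r s] r s rs by simp
      next
        case 4
        then show False using middle[OF T(1), of p r s] r s rs by (simp add: insert_commute add.commute)
      qed
    next
      case False
      then have "{p, q, r} \<in> K" "{p, q, s} \<in> K" using old r s by auto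
      then show False using fano.convex_wall[OF dim_3 _ r(2) _ s(2) rs(1), of 1 1] rs(2) by simp
    qed
  qed
  then show "fano_complex N (star K S)" by (simp add: K'_def)
  have "points_resolved K' L"
    unfolding points_resolved_def
  proof (intro ballI impI, rule ccontr)
    fix F assume F: "F \<in> K'" "card F = 3" "\<Sum>F \<in> \<Union>L" and no: "\<not> (\<exists>p\<in>F. \<exists>q\<in>F. p \<noteq> q \<and> p + q \<in> \<Union>L)"
    show False
    proof (cases "\<exists>T\<in>S. \<Sum>T \<in> F")
      case True
      then obtain T where T: "T \<in> S" "\<Sum>T \<in> F" by blast
      have "card (F - {\<Sum>T}) = 2" using F T K'.face_finite[OF F(1)] by simp
      then obtain q r where "F - {\<Sum>T} = {q, r}" "q \<noteq> r" by (meson card_2_iff)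
      then have Fe: "F = {\<Sum>T, q, r}" and d: "q \<noteq> r" "\<Sum>T \<noteq> q" "\<Sum>T \<noteq> r" using T by auto
      have qr: "q \<in> T" "r \<in> T" using new[of T q r] F T Fe by auto
      have fin: "finite T" using face_finite S(1) T by blast
      have "card (T - {q, r}) = 1" using qr d S(2)[OF T(1)] by (simp add: card_Diff_subset)
      then obtain t where "T - {q, r} = {t}" by (meson card_1_singletonE)
      then have Tq: "T = {q, r, t}" and dt: "t \<noteq> q" "t \<noteq> r" using qr by auto
      have tK: "{q, r, t} \<in> K" "card {q, r, t} = 3" using S[OF T(1)] Tq by auto
      have sT: "\<Sum>T = q + r + t" using d dt by (simp add: Tq add.assoc)
      have sF: "\<Sum>F = \<Sum>T + q + r" using d by (simp add: Fe add.assoc)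
      have "\<Sum>F + t = 2 *\<^sub>R \<Sum>T" unfolding sF by (simp add: sT scaleR_2 algebra_simps)
      then have "\<Sum>F = \<Sum>T"
        using fine.midpoint_vertex[OF F(3) _ S(3)[OF T(1)], of t] face_vertices[OF tK(1)] by simp
      then have "q + r = 0" unfolding sF by (simp add: add.assoc)
      then show False using triangle_independent(1)[OF tK, of 1 1 0] by simp
    next
      case False
      then have "F \<in> K" using old F(1) by blast
      then have FS: "F \<in> S" using F no by (auto simp: S_def)
      have "F \<in> star K S" using F(1) by (simp add: K'_def)
      then show False
      proof (cases rule: starE)
        case old
        then show ?thesis using FS by blast
      next
        case (new T C)
        then show ?thesis using False by blast
      qed
    qed
  qed
  then show "points_resolved (star K S) L" by (simp add: K'_def)
qed


section \<open>The decomposition\<close>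

text \<open>
  Every blow-up adds one of the finitely many generators of \<open>L\<close>.
\<close>

theorem curve_blow_up_chain:
  assumes "coarser_complex N K L" "fano_complex N K" "points_resolved K L"
  shows "\<exists>n \<Psi>. \<Psi> 0 = K \<and> \<Psi> n = L \<and> (\<forall>i\<le>n. fano_complex N (\<Psi> i)) \<and>
    (\<forall>i<n. \<exists>T\<in>\<Psi> i. card T = 2 \<and> \<Psi> (Suc i) = star (\<Psi> i) {T})"
  using assms
proof (induction "card (\<Union>L) - card (\<Union>K)" arbitrary: K rule: less_induct)
  case less
  interpret coarser_complex N K L by (rule less.prems(1))
  show ?case
  proof (cases "\<exists>a b. {a, b} \<in> K \<and> a \<noteq> b \<and> a + b \<in> \<Union>L")
    case False
    then have "p + q \<notin> \<Union>L" if "{p, q} \<in> K" "p \<noteq> q" for p q using that by blast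
    moreover have "\<Sum>T \<notin> \<Union>L" if T: "T \<in> K" "card T = 3" for T
    proof
      assume "\<Sum>T \<in> \<Union>L"
      then obtain p q where pq: "p \<in> T" "q \<in> T" "p \<noteq> q" "p + q \<in> \<Union>L"
        using less.prems(3) T unfolding points_resolved_def by blast
      then have "{p, q} \<in> K" using subset_closed[OF T(1), of "{p, q}"] by simp
      then show False using False pq by blast
    qed
    ultimately have "K = L" by (intro unsubdivided_eq)
    then show ?thesis using less.prems(2) by (intro exI[of _ 0] exI[of _ "\<lambda>_. K"]) simp
  next
    case True
    then obtain a b where ab: "{a, b} \<in> K" "a \<noteq> b" "a + b \<in> \<Union>L" by blast
    let ?K = "star K {{a, b}}"
    note step = curve_blow_up[OF less.prems ab]
    have fin: "finite (\<Union>L)" using fine.finite_complex fine.face_finite by blast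
    have "\<Union>?K \<subseteq> \<Union>L" using step(4) ab(3) vertices by simp
    then have "card (\<Union>?K) \<le> card (\<Union>L)" using fin card_mono by blast
    moreover have "card (\<Union>?K) = Suc (card (\<Union>K))"
      using step(4,5) finite_subset[OF vertices fin] by simp
    ultimately have "card (\<Union>L) - card (\<Union>?K) < card (\<Union>L) - card (\<Union>K)" by simp
    then obtain n \<Psi> where \<Psi>: "\<Psi> 0 = ?K" "\<Psi> n = L" "\<forall>i\<le>n. fano_complex N (\<Psi> i)"
      "\<forall>i<n. \<exists>T\<in>\<Psi> i. card T = 2 \<and> \<Psi> (Suc i) = star (\<Psi> i) {T}"
      using less.hyps[OF _ step(1,2,3)] by blast
    define \<Psi>' where "\<Psi>' = (\<lambda>i. case i of 0 \<Rightarrow> K | Suc j \<Rightarrow> \<Psi> j)"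
    have "\<Psi>' 0 = K" "\<Psi>' (Suc n) = L" using \<Psi> by (auto simp: \<Psi>'_def)
    moreover have "\<forall>i\<le>Suc n. fano_complex N (\<Psi>' i)"
      using \<Psi>(3) less.prems(2) by (auto simp: \<Psi>'_def split: nat.split)
    moreover have "\<forall>i<Suc n. \<exists>T\<in>\<Psi>' i. card T = 2 \<and> \<Psi>' (Suc i) = star (\<Psi>' i) {T}"
    proof (intro allI impI)
      fix i assume "i < Suc n"
      show "\<exists>T\<in>\<Psi>' i. card T = 2 \<and> \<Psi>' (Suc i) = star (\<Psi>' i) {T}"
      proof (cases i)
        case 0
        then show ?thesis using ab \<Psi>(1) by (intro bexI[of _ "{a, b}"]) (auto simp: \<Psi>'_def)
      next
        case (Suc j)
        then show ?thesis using \<Psi>(4) \<open>i < Suc n\<close> by (simp add: \<Psi>'_def)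
      qed
    qed
    ultimately show ?thesis by blast
  qed
qed

theorem theorem5p5:
  fixes N :: "'a::euclidean_space set" and \<Delta>X \<Delta>Y :: "'a set set"
  assumes "DIM('a) = 3"
    and "full_lattice N"
    and "nonsingular_toric_fano N \<Delta>X"
    and "nonsingular_toric_fano N \<Delta>Y"
    and "equivariant_morphism \<Delta>Y \<Delta>X"
  shows "\<exists>(r::nat) (\<Phi> :: nat \<Rightarrow> 'a set set).
           1 \<le> r \<and> \<Phi> 0 = \<Delta>X \<and> \<Phi> r = \<Delta>Y \<and>
           (\<forall>i\<le>r. nonsingular_toric_fano N (\<Phi> i)) \<and>
           (\<forall>j\<in>{2..r}. blow_up_along_curve N (\<Phi> j) (\<Phi> (j - 1))) \<and>
           blow_up_along_points N (\<Phi> 1) (\<Phi> 0)"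
proof -
  define K where "K = complex_of N \<Delta>X"
  define L where "L = complex_of N \<Delta>Y"
  have fanoK: "fano_complex N K" and fanoL: "fano_complex N L"
    using complex_of_fano assms(3,4) by (auto simp: K_def L_def)
  interpret K: fano_complex N K by (rule fanoK)
  interpret L: fano_complex N L by (rule fanoL)
  have X: "ccone ` K = \<Delta>X" and Y: "ccone ` L = \<Delta>Y"
    using assms(3,4) complex_of_smooth(2) by (auto simp: K_def L_def nonsingular_toric_fano_def)
  have coarser: "coarser_complex N K L"
    using morphism_vertices[OF K.smooth_complex_axioms L.smooth_complex_axioms] assms(1,5) X Y
    by unfold_locales auto
  define S where "S = {T\<in>K. card T = 3 \<and> \<Sum>T \<in> \<Union>L \<and> (\<forall>p\<in>T. \<forall>q\<in>T. p \<noteq> q \<longrightarrow> p + q \<notin> \<Union>L)}"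
  obtain n \<Psi> where \<Psi>: "\<Psi> 0 = star K S" "\<Psi> n = L" "\<forall>i\<le>n. fano_complex N (\<Psi> i)"
    "\<forall>i<n. \<exists>T\<in>\<Psi> i. card T = 2 \<and> \<Psi> (Suc i) = star (\<Psi> i) {T}"
    using curve_blow_up_chain[OF point_blow_ups[OF coarser fanoK S_def]] by blast
  define \<Phi> where "\<Phi> = (\<lambda>i. case i of 0 \<Rightarrow> \<Delta>X | Suc j \<Rightarrow> ccone ` \<Psi> j)"
  have "\<forall>i\<le>Suc n. nonsingular_toric_fano N (\<Phi> i)"
    using \<Psi>(3) assms(1,3) fano_cones by (auto simp: \<Phi>_def split: nat.split)
  moreover have "\<forall>j\<in>{2..Suc n}. blow_up_along_curve N (\<Phi> j) (\<Phi> (j - 1))"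
  proof
    fix j assume j: "j \<in> {2..Suc n}"
    then obtain i where i: "j = Suc (Suc i)" "i < n" by (cases j; cases "j - 1") auto
    then obtain T where T: "T \<in> \<Psi> i" "card T = 2" "\<Psi> (Suc i) = star (\<Psi> i) {T}" using \<Psi>(4) by blast
    interpret P: fano_complex N "\<Psi> i" using \<Psi>(3) i by simp
    have "orbit_dim (ccone T) = 1" using P.orbit_dim_face[OF T(1)] T(2) assms(1) by simp
    moreover have "ccone ` \<Psi> (Suc i) = blow_up N (ccone ` \<Psi> i) {ccone T}"
      using P.blow_up_cones[of "{T}"] T by simp
    ultimately show "blow_up_along_curve N (\<Phi> j) (\<Phi> (j - 1))"
      using T(1) by (auto simp: blow_up_along_curve_def \<Phi>_def i(1))
  qed
  moreover have "blow_up_along_points N (\<Phi> 1) (\<Phi> 0)"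
    unfolding blow_up_along_points_def
  proof (intro exI conjI)
    show "finite (ccone ` S)" using K.finite_complex by (simp add: S_def)
    show "ccone ` S \<subseteq> {\<tau> \<in> \<Phi> 0. orbit_dim \<tau> = 0}"
      using K.orbit_dim_face assms(1) by (auto simp: S_def \<Phi>_def X[symmetric])
    show "\<Phi> 1 = blow_up N (\<Phi> 0) (ccone ` S)"
      using K.blow_up_cones[of S] \<Psi>(1) by (simp add: S_def \<Phi>_def X[symmetric])
  qed
  ultimately show ?thesis
    using \<Psi>(2) Y by (intro exI[of _ "Suc n"] exI[of _ \<Phi>]) (simp add: \<Phi>_def)
qed

end
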